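(* Let $\mathcal X,\mathcal Y,\mathcal Z$ be measurable spaces and $\mathbf K(X,Y|Z):\mathcal Z\dashrightarrow\mathcal X\times\mathcal Y$ a Markov kernel with marginal $\mathbf K(Y|Z)$. Assume one of the following: 1. $\mathcal X$ is standard, $\mathcal Y$ is countably generated, $\mathcal Z$ is arbitrary; 2. $\mathcal X$ is standard, $\mathcal Y$ is arbitrary, $\mathcal Z$ is discrete; 3. $\mathcal X$ is arbitrary, $\mathcal Y$ is discrete, $\mathcal Z$ is arbitrary; 4. $\mathbf K(X,Y|Z=z)\ll\boldsymbol\mu\otimes\boldsymbol\nu$ for all $z\in\mathcal Z$, for $\sigma$-finite measures $\boldsymbol\mu$ on $\mathcal X$ and $\boldsymbol\nu$ on $\mathcal Y$, with a density $k(x,y|z)\in[0,\infty)$ that is jointly measurable in $(x,y,z)$; 5. there is a measurable map $\varphi:\mathcal Y\times\mathcal Z\to\mathcal X$ with $\mathbf K(X,Y|Z)=\boldsymbol\delta_\varphi(X|Y,Z)\otimes\mathbf K(Y|Z)$; 6. there is a measurable map $\varphi:\mathcal Z\to\mathcal Y$ with $\mathbf K(Y|Z=z)=\boldsymbol\delta_{\varphi(z)}$ for every $z\in\mathcal Z$. Then a conditional Markov kernel of $\mathbf K(X,Y|Z)$ conditioned on $Y$ given $Z$ exists, i.e. a Markov kernel $\mathbf K(X|Y,Z):\mathcal Y\times\mathcal Z\dashrightarrow\mathcal X$ with $$\mathbf K(X,Y|Z)=\mathbf K(X|Y,Z)\otimes\mathbf K(Y|Z).$$ In case 4 it is given by $\mathbf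 K(X\in A|Y=y,Z=z)=\int_A k(x|y,z)\,\boldsymbol\mu(dx)$ with $$k(x|y,z)=\frac{k(x,y|z)}{k(y|z)},\qquad k(y|z):=\int_{\mathcal X}k(x,y|z)\,\boldsymbol\mu(dx),$$ wherever $0<k(y|z)<\infty$, and by an arbitrary fixed probability measure on $\mathcal X$ elsewhere. In each of the cases 1, 2, 3, $(\mathcal X,\mathcal Y,\mathcal Z)$ is a disintegration triple, i.e. every Markov kernel $\mathcal Z\dashrightarrow\mathcal X\times\mathcal Y$ admits a conditional Markov kernel in this sense.
   Context: A Markov kernel $\mathbf K(W|T):\mathcal T\dashrightarrow\mathcal W$ between measurable spaces is a map $(D,t)\mapsto\mathbf K(W\in D|T=t)\in[0,1]$ that is a probability measure in the measurable set $D\subseteq\mathcal W$ for each $t$ and measurable in $t$ for each $D$. Product spaces carry the product $\sigma$-algebra. The marginal is $\mathbf K(Y\in B|Z=z)=\mathbf K(X\in\mathcal X,Y\in B|Z=z)$. The product $\mathbf K(X|Y,Z)\otimes\mathbf K(Y|Z):\mathcal Z\dashrightarrow\mathcal X\times\mathcal Y$ is the kernel with value $\int_B\mathbf K(X\in A|Y=y,Z=z)\,\mathbf K(Y\in dy|Z=z)$ on $A\times B$ at $z$. For a measurable map $\varphi$, $\boldsymbol\delta_\varphi(X\in A|Y=y,Z=z)=\mathbf 1_A(\varphi(y,z))$. A measurable space is standard if it is measurably isomorphic to a Borel subset of $[0,1]$; countably generated if its $\sigma$-algebra is generated by a countable family of sets; discrete (in this paper) if it is countable and its $\sigma$-algebra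 is the full power set. *)

theory Defs
  imports "HOL-Probability.Probability"
begin

text \<open>
  A measurable space is represented by a value of type \<^typ>\<open>'a measure\<close> of which only
  \<^const>\<open>space\<close> and \<^const>\<open>sets\<close> are used. A Markov kernel from \<open>T\<close> to \<open>W\<close> is a measurable map
  \<open>K \<in> T \<rightarrow>\<^sub>M prob_algebra W\<close>; the lemma below spells this out. The values of a kernel outside
  \<open>space T\<close> carry no meaning, so kernels are only ever compared on \<open>space T\<close>.
\<close>

lemma markov_kernel_iff:
  "K \<in> T \<rightarrow>\<^sub>M prob_algebra W \<longleftrightarrow>
     (\<forall>t\<in>space T. prob_space (K t) \<and> sets (K t) = sets W) \<and>
     (\<forall>D\<in>sets W. (\<lambda>t. emeasure (K t) D) \<in> borel_measurable T)"
proof safe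
  fix t assume K: "K \<in> T \<rightarrow>\<^sub>M prob_algebra W" and t: "t \<in> space T"
  from measurable_space[OF K t] show "prob_space (K t)"
    by (simp add: space_prob_algebra)
next
  fix t assume K: "K \<in> T \<rightarrow>\<^sub>M prob_algebra W" and t: "t \<in> space T"
  from measurable_space[OF K t] have "sets (K t) = sets W"
    by (simp add: space_prob_algebra)
  then show "D \<in> sets (K t) \<Longrightarrow> D \<in> sets W" "D \<in> sets W \<Longrightarrow> D \<in> sets (K t)" for D
    by simp_all
next
  fix D assume K: "K \<in> T \<rightarrow>\<^sub>M prob_algebra W" and D: "D \<in> sets W"
  show "(\<lambda>t. emeasure (K t) D) \<in> borel_measurable T"
    using measurable_emeasure_kernel[OF measurable_prob_algebraD[OF K] D] .
next
  assume *: "\<forall>t\<in>space T. prob_space (K t) \<and> sets (K t) = sets W"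
    and "\<forall>D\<in>sets W. (\<lambda>t. emeasure (K t) D) \<in> borel_measurable T"
  then show "K \<in> T \<rightarrow>\<^sub>M prob_algebra W"
    by (intro measurable_prob_algebraI measurable_subprob_algebra)
       (auto intro: prob_space_imp_subprob_space)
qed

definition standard_space :: "'a measure \<Rightarrow> bool" where
  "standard_space M \<longleftrightarrow>
     (\<exists>B\<in>sets (borel :: real measure). B \<subseteq> {0..1} \<and>
       (\<exists>f g. f \<in> M \<rightarrow>\<^sub>M restrict_space borel B \<and> g \<in> restrict_space borel B \<rightarrow>\<^sub>M M \<and>
              (\<forall>x\<in>space M. g (f x) = x) \<and> (\<forall>r\<in>B. f (g r) = r)))"

definition countably_generated_space :: "'a measure \<Rightarrow> bool" where
  "countably_generated_space M \<longleftrightarrow>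
     (\<exists>\<E>. countable \<E> \<and> \<E> \<subseteq> Pow (space M) \<and> sets M = sigma_sets (space M) \<E>)"

definition discrete_space :: "'a measure \<Rightarrow> bool" where
  "discrete_space M \<longleftrightarrow> countable (space M) \<and> sets M = Pow (space M)"

definition marginal_snd :: "'b measure \<Rightarrow> ('c \<Rightarrow> ('a \<times> 'b) measure) \<Rightarrow> 'c \<Rightarrow> 'b measure" where
  "marginal_snd Y K z = distr (K z) Y snd"

definition delta_kernel :: "'a measure \<Rightarrow> ('t \<Rightarrow> 'a) \<Rightarrow> 't \<Rightarrow> 'a measure" where
  "delta_kernel X \<phi> t = return X (\<phi> t)"

text \<open>
  The product of \<open>Q :: Y \<times> Z \<rightarrow> X\<close> and \<open>L :: Z \<rightarrow> Y\<close>: draw \<open>y\<close> from \<open>L z\<close>, then \<open>x\<close> from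
  \<open>Q (y, z)\<close>, and return \<open>(x, y)\<close>. Lemma \<open>eq_kernel_product_iff\<close> below shows that this is the
  unique measure with the defining integral as value on measurable rectangles.
\<close>

definition kernel_product ::
  "'a measure \<Rightarrow> 'b measure \<Rightarrow> ('b \<times> 'c \<Rightarrow> 'a measure) \<Rightarrow> ('c \<Rightarrow> 'b measure) \<Rightarrow>
   'c \<Rightarrow> ('a \<times> 'b) measure" where
  "kernel_product X Y Q L z = L z \<bind> (\<lambda>y. distr (Q (y, z)) (X \<Otimes>\<^sub>M Y) (\<lambda>x. (x, y)))"

lemma emeasure_marginal_snd:
  assumes K: "K \<in> Z \<rightarrow>\<^sub>M prob_algebra (X \<Otimes>\<^sub>M Y)" and z: "z \<in> space Z" and B: "B \<in> sets Y"
  shows "emeasure (marginal_snd Y K z) B = emeasure (K z) (space X \<times> B)"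
proof -
  have s: "sets (K z) = sets (X \<Otimes>\<^sub>M Y)"
    using measurable_space[OF K z] by (simp add: space_prob_algebra)
  have "snd \<in> K z \<rightarrow>\<^sub>M Y"
    by (subst measurable_cong_sets[OF s refl]) simp
  moreover have "snd -` B \<inter> space (K z) = space X \<times> B"
    using sets_eq_imp_space_eq[OF s] sets.sets_into_space[OF B] by (auto simp: space_pair_measure)
  ultimately show ?thesis
    using B by (simp add: marginal_snd_def emeasure_distr)
qed

lemma kernel_product_kernel:
  assumes Q: "Q \<in> Y \<Otimes>\<^sub>M Z \<rightarrow>\<^sub>M prob_algebra X" and L: "L \<in> Z \<rightarrow>\<^sub>M prob_algebra Y"
  shows "kernel_product X Y Q L \<in> Z \<rightarrow>\<^sub>M prob_algebra (X \<Otimes>\<^sub>M Y)"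
proof -
  note Q [measurable] L [measurable]
  have "(\<lambda>p. distr (Q (snd p, fst p)) (X \<Otimes>\<^sub>M Y) (\<lambda>x. (x, snd p)))
          \<in> Z \<Otimes>\<^sub>M Y \<rightarrow>\<^sub>M prob_algebra (X \<Otimes>\<^sub>M Y)"
    by (rule measurable_distr_prob_space2[where M = X]) measurable
  then have "(\<lambda>z. L z \<bind> (\<lambda>y. distr (Q (y, z)) (X \<Otimes>\<^sub>M Y) (\<lambda>x. (x, y))))
          \<in> Z \<rightarrow>\<^sub>M prob_algebra (X \<Otimes>\<^sub>M Y)"
    by (intro measurable_bind_prob_space2[OF L]) (simp add: case_prod_beta')
  then show ?thesis
    by (simp add: kernel_product_def[abs_def])
qed

lemma emeasure_kernel_product_times:
  assumes Q: "Q \<in> Y \<Otimes>\<^sub>M Z \<rightarrow>\<^sub>M prob_algebra X" and L: "L \<in> Z \<rightarrow>\<^sub>M prob_algebra Y"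
    and z: "z \<in> space Z" and A: "A \<in> sets X" and B: "B \<in> sets Y"
  shows "emeasure (kernel_product X Y Q L z) (A \<times> B) = (\<integral>\<^sup>+y\<in>B. emeasure (Q (y, z)) A \<partial>L z)"
proof -
  note Q [measurable] L [measurable]
  have Lz: "prob_space (L z)" "sets (L z) = sets Y"
    using measurable_space[OF L z] by (simp_all add: space_prob_algebra)
  have spL: "space (L z) = space Y"
    by (rule sets_eq_imp_space_eq[OF Lz(2)])
  have "(\<lambda>y. distr (Q (y, z)) (X \<Otimes>\<^sub>M Y) (\<lambda>x. (x, y))) \<in> Y \<rightarrow>\<^sub>M prob_algebra (X \<Otimes>\<^sub>M Y)"
    using z by (intro measurable_distr_prob_space2[where M = X]) measurable
  then have N: "(\<lambda>y. distr (Q (y, z)) (X \<Otimes>\<^sub>M Y) (\<lambda>x. (x, y))) \<in> L z \<rightarrow>\<^sub>M subprob_algebra (X \<Otimes>\<^sub>M Y)"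
    by (subst measurable_cong_sets[OF Lz(2) refl]) (rule measurable_prob_algebraD)
  have "emeasure (kernel_product X Y Q L z) (A \<times> B) =
      (\<integral>\<^sup>+y. emeasure (distr (Q (y, z)) (X \<Otimes>\<^sub>M Y) (\<lambda>x. (x, y))) (A \<times> B) \<partial>L z)"
    unfolding kernel_product_def using A B prob_space.not_empty[OF Lz(1)]
    by (intro emeasure_bind[OF _ N]) auto
  also have "\<dots> = (\<integral>\<^sup>+y\<in>B. emeasure (Q (y, z)) A \<partial>L z)"
  proof (rule nn_integral_cong)
    fix y assume "y \<in> space (L z)"
    then have y: "y \<in> space Y" by (simp add: spL)
    have s: "sets (Q (y, z)) = sets X"
      using measurable_space[OF Q, of "(y, z)"] y z by (simp add: space_prob_algebra space_pair_measure)
    have "(\<lambda>x. (x, y)) \<in> Q (y, z) \<rightarrow>\<^sub>M X \<Otimes>\<^sub>M Y"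
      using y by (subst measurable_cong_sets[OF s refl]) simp
    moreover have "(\<lambda>x. (x, y)) -` (A \<times> B) \<inter> space (Q (y, z)) = (if y \<in> B then A else {})"
      using sets_eq_imp_space_eq[OF s] sets.sets_into_space[OF A] by auto
    ultimately show "emeasure (distr (Q (y, z)) (X \<Otimes>\<^sub>M Y) (\<lambda>x. (x, y))) (A \<times> B) =
        emeasure (Q (y, z)) A * indicator B y"
      using A B by (simp add: emeasure_distr)
  qed
  finally show ?thesis .
qed

lemma eq_kernel_product_iff:
  assumes Q: "Q \<in> Y \<Otimes>\<^sub>M Z \<rightarrow>\<^sub>M prob_algebra X" and L: "L \<in> Z \<rightarrow>\<^sub>M prob_algebra Y"
    and z: "z \<in> space Z" and M: "sets M = sets (X \<Otimes>\<^sub>M Y)"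
  shows "M = kernel_product X Y Q L z \<longleftrightarrow>
    (\<forall>A\<in>sets X. \<forall>B\<in>sets Y. emeasure M (A \<times> B) = (\<integral>\<^sup>+y\<in>B. emeasure (Q (y, z)) A \<partial>L z))"
    (is "?l \<longleftrightarrow> ?r")
proof
  assume ?l then show ?r
    using emeasure_kernel_product_times[OF Q L z] by simp
next
  assume r: ?r
  let ?P = "kernel_product X Y Q L z"
  have P: "prob_space ?P" "sets ?P = sets (X \<Otimes>\<^sub>M Y)"
    using measurable_space[OF kernel_product_kernel[OF Q L] z] by (simp_all add: space_prob_algebra)
  have eq: "emeasure M (A \<times> B) = emeasure ?P (A \<times> B)" if "A \<in> sets X" "B \<in> sets Y" for A B
    using r that emeasure_kernel_product_times[OF Q L z] by simp
  have "emeasure ?P (space X \<times> space Y) \<noteq> \<infinity>"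
    using finite_measure.emeasure_finite[OF prob_space.finite_measure[OF P(1)]] by simp
  then have fin: "emeasure M (space X \<times> space Y) \<noteq> \<infinity>"
    using eq[of "space X" "space Y"] by simp
  show ?l
  proof (rule measure_eqI_generator_eq[OF Int_stable_pair_measure_generator[of X Y],
        where \<Omega> = "space X \<times> space Y" and A = "\<lambda>_. space X \<times> space Y"])
    show "{a \<times> b |a b. a \<in> sets X \<and> b \<in> sets Y} \<subseteq> Pow (space X \<times> space Y)"
      by (rule pair_measure_closed)
    show "sets M = sigma_sets (space X \<times> space Y) {a \<times> b |a b. a \<in> sets X \<and> b \<in> sets Y}"
      "sets ?P = sigma_sets (space X \<times> space Y) {a \<times> b |a b. a \<in> sets X \<and> b \<in> sets Y}"
      using M P(2) by (simp_all only: sets_pair_measure)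
    show "range (\<lambda>_::nat. space X \<times> space Y) \<subseteq> {a \<times> b |a b. a \<in> sets X \<and> b \<in> sets Y}"
      by blast
    show "(\<Union>i::nat. space X \<times> space Y) = space X \<times> space Y"
      by simp
    show "emeasure M D = emeasure ?P D" if "D \<in> {a \<times> b |a b. a \<in> sets X \<and> b \<in> sets Y}" for D
      using that eq by blast
    show "emeasure M (space X \<times> space Y) \<noteq> \<infinity>"
      by (rule fin)
  qed
qed

definition conditional_kernel ::
  "'a measure \<Rightarrow> 'b measure \<Rightarrow> 'c measure \<Rightarrow> ('c \<Rightarrow> ('a \<times> 'b) measure) \<Rightarrow>
   ('b \<times> 'c \<Rightarrow> 'a measure) \<Rightarrow> bool" where
  "conditional_kernel X Y Z K Q \<longleftrightarrow>
     Q \<in> Y \<Otimes>\<^sub>M Z \<rightarrow>\<^sub>M prob_algebra X \<and>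
     (\<forall>z\<in>space Z. K z = kernel_product X Y Q (marginal_snd Y K) z)"

definition disintegration_triple :: "'a measure \<Rightarrow> 'b measure \<Rightarrow> 'c measure \<Rightarrow> bool" where
  "disintegration_triple X Y Z \<longleftrightarrow>
     (\<forall>K \<in> Z \<rightarrow>\<^sub>M prob_algebra (X \<Otimes>\<^sub>M Y). \<exists>Q. conditional_kernel X Y Z K Q)"

definition has_joint_density ::
  "'a measure \<Rightarrow> 'b measure \<Rightarrow> 'c measure \<Rightarrow> ('c \<Rightarrow> ('a \<times> 'b) measure) \<Rightarrow>
   'a measure \<Rightarrow> 'b measure \<Rightarrow> ('a \<Rightarrow> 'b \<Rightarrow> 'c \<Rightarrow> real) \<Rightarrow> bool" where
  "has_joint_density X Y Z K \<mu> \<nu> k \<longleftrightarrow>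
     sigma_finite_measure \<mu> \<and> sets \<mu> = sets X \<and>
     sigma_finite_measure \<nu> \<and> sets \<nu> = sets Y \<and>
     (\<lambda>(x, y, z). k x y z) \<in> borel_measurable (X \<Otimes>\<^sub>M Y \<Otimes>\<^sub>M Z) \<and>
     (\<forall>x\<in>space X. \<forall>y\<in>space Y. \<forall>z\<in>space Z. 0 \<le> k x y z) \<and>
     (\<forall>z\<in>space Z. absolutely_continuous (\<mu> \<Otimes>\<^sub>M \<nu>) (K z) \<and>
        K z = density (\<mu> \<Otimes>\<^sub>M \<nu>) (\<lambda>(x, y). ennreal (k x y z)))"

definition marginal_density ::
  "'a measure \<Rightarrow> ('a \<Rightarrow> 'b \<Rightarrow> 'c \<Rightarrow> real) \<Rightarrow> 'b \<Rightarrow> 'c \<Rightarrow> ennreal" where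
  "marginal_density \<mu> k y z = (\<integral>\<^sup>+x. ennreal (k x y z) \<partial>\<mu>)"

definition density_quotient_kernel ::
  "'a measure \<Rightarrow> ('a \<Rightarrow> 'b \<Rightarrow> 'c \<Rightarrow> real) \<Rightarrow> 'a measure \<Rightarrow> 'b \<times> 'c \<Rightarrow> 'a measure" where
  "density_quotient_kernel \<mu> k P = (\<lambda>(y, z).
     if 0 < marginal_density \<mu> k y z \<and> marginal_density \<mu> k y z < \<infinity>
     then density \<mu> (\<lambda>x. ennreal (k x y z) / marginal_density \<mu> k y z)
     else P)"

end

theory Submission
  imports Defs
begin

text \<open>
  Write \<open>L z\<close> for the marginal of \<open>K z\<close> on \<open>Y\<close>. Both sides of the disintegration identity are
  finite measures on a product, so everything is decided on rectangles: a kernel \<open>Q\<close> is a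
  conditional kernel iff \<open>K z (A \<times> B)\<close> is the integral of \<open>Q (y, z) A\<close> over \<open>y \<in> B\<close>
  against \<open>L z\<close> (\<open>conditional_kernel_iff\<close>). When \<open>Y\<close> is discrete, when the marginal is
  deterministic, when \<open>X\<close> is a function of \<open>(Y, Z)\<close>, and when there is a joint density, an
  explicit \<open>Q\<close> satisfies this criterion.

  The substance is the case of a standard \<open>X\<close>, which splits into two independent problems.

  The first is to find, for one fixed event \<open>A\<close>, a conditional probability of \<open>A\<close> that is
  \<^emph>\<open>jointly\<close> measurable in \<open>(y, z)\<close>. For each single \<open>z\<close> the Radon-Nikodym theorem gives
  one, and if \<open>Z\<close> is discrete these can be put side by side. If \<open>Y\<close> is generated by sets \<open>E 0, E
  1, \<dots>\<close>, the first \<open>n\<close> of them cut \<open>Y\<close> into finitely many cells, and the ratio \<open>K z (A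
  \<times> cell) / L z cell\<close> of the cell containing \<open>y\<close> defines a function \<open>M n (y, z)\<close> that is
  visibly jointly measurable. For fixed \<open>z\<close> these functions are the successive conditional
  expectations of the Radon-Nikodym density, hence orthogonal projections in \<open>L2\<close>; their norms
  increase and are bounded, so the sequence is Cauchy in \<open>L2\<close> and in \<open>L1\<close>
  (\<open>L2_increasing_imp_L1_Cauchy\<close>). Martingale convergence is replaced by the following remark: a
  sequence which is Cauchy in \<open>L1 (L z)\<close> has an almost surely convergent subsequence, and taking
  the \<^emph>\<open>least\<close> indices that work makes the subsequence a measurable function of \<open>z\<close>, so
  the limit is still jointly measurable (\<open>measurable_AE_limit_of_kernel_Cauchy\<close>). The limit has
  the right integrals over all finite unions of cells, which form a generating \<open>\<pi>\<close>-system.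

  The second is to assemble a kernel from the conditional probabilities \<open>h (y, z) r\<close> of the
  events \<open>X \<le> r\<close> for rational \<open>r\<close>, where \<open>X\<close> is first taken to be the real line with all
  mass on \<open>[0, 1]\<close>. The kernel is the law of the quantile \<open>Inf {r. u \<le> h (y, z) r}\<close> for \<open>u\<close>
  uniform on \<open>(0, 1)\<close>. Its measurability is immediate, and it is a probability measure for
  \<^emph>\<open>every\<close> \<open>(y, z)\<close>, so there is no exceptional null set to repair; almost sure
  monotonicity of \<open>h\<close> in \<open>r\<close> is used only to evaluate integrals
  (\<open>conditional_kernel_unit_interval\<close>). Finally a standard space is a measurable retract of the
  real line, and conditional kernels pass to retracts (\<open>conditional_kernel_retract\<close>).
\<close>

section \<open>Kernels, marginals and rectangles\<close>

lemma kernelD: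
  assumes "K \<in> T \<rightarrow>\<^sub>M prob_algebra W" "t \<in> space T"
  shows "prob_space (K t)" "sets (K t) = sets W" "space (K t) = space W"
  using measurable_space[OF assms] sets_eq_imp_space_eq[of "K t" W] by (simp_all add: space_prob_algebra)

lemma marginal_snd_kernel:
  assumes "K \<in> Z \<rightarrow>\<^sub>M prob_algebra (X \<Otimes>\<^sub>M Y)"
  shows "marginal_snd Y K \<in> Z \<rightarrow>\<^sub>M prob_algebra Y"
  unfolding marginal_snd_def[abs_def]
  by (rule measurable_compose[OF assms measurable_distr_prob_space]) simp

lemma conditional_kernel_iff:
  assumes K: "K \<in> Z \<rightarrow>\<^sub>M prob_algebra (X \<Otimes>\<^sub>M Y)"
  shows "conditional_kernel X Y Z K Q \<longleftrightarrow>
    Q \<in> Y \<Otimes>\<^sub>M Z \<rightarrow>\<^sub>M prob_algebra X \<and>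
    (\<forall>z\<in>space Z. \<forall>A\<in>sets X. \<forall>B\<in>sets Y.
       emeasure (K z) (A \<times> B) = (\<integral>\<^sup>+y\<in>B. emeasure (Q (y, z)) A \<partial>marginal_snd Y K z))"
  unfolding conditional_kernel_def
  using eq_kernel_product_iff[OF _ marginal_snd_kernel[OF K], of Q X _ "K _"] kernelD(2)[OF K]
  by (intro conj_cong refl ball_cong) auto

text \<open>
  No probability measure lives on a product with an empty factor, so an empty \<open>X\<close> forces \<open>Z\<close> to
  be empty. The remaining existence proofs may therefore pick a point of \<open>X\<close> as a default value.
\<close>
lemma conditional_kernel_empty:
  assumes K: "K \<in> Z \<rightarrow>\<^sub>M prob_algebra (X \<Otimes>\<^sub>M Y)" and X: "space X = {}"
  shows "conditional_kernel X Y Z K Q"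
proof -
  have "space Z = {}"
  proof (rule ccontr)
    assume "space Z \<noteq> {}"
    then obtain z where z: "z \<in> space Z" by auto
    show False
      using kernelD(3)[OF K z] prob_space.not_empty[OF kernelD(1)[OF K z]] X
      by (simp add: space_pair_measure)
  qed
  then show ?thesis
    by (simp add: conditional_kernel_def measurable_def space_pair_measure)
qed

text \<open>
  The measure \<open>B \<mapsto> M (A \<times> B)\<close>. For a fixed \<open>A\<close>, a conditional probability of \<open>A\<close>
  is a density of it with respect to the marginal.
\<close>
definition slice_measure :: "'b measure \<Rightarrow> ('a \<times> 'b) measure \<Rightarrow> 'a set \<Rightarrow> 'b measure" where
  "slice_measure Y M A = distr (density M (indicator (A \<times> space Y))) Y snd"

lemma sets_slice_measure [simp, measurable_cong]: "sets (slice_measure Y M A) = sets Y"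
  by (simp add: slice_measure_def)

lemma emeasure_slice_measure:
  assumes M: "sets M = sets (X \<Otimes>\<^sub>M Y)" and A: "A \<in> sets X" and B: "B \<in> sets Y"
  shows "emeasure (slice_measure Y M A) B = emeasure M (A \<times> B)"
proof -
  note M [measurable_cong]
  have sp: "space M = space X \<times> space Y"
    using sets_eq_imp_space_eq[OF M] by (simp add: space_pair_measure)
  have AY: "A \<times> space Y \<in> sets M" "space X \<times> B \<in> sets M" using M A B by auto
  have "emeasure (slice_measure Y M A) B = emeasure (density M (indicator (A \<times> space Y))) (snd -` B \<inter> space M)"
    unfolding slice_measure_def using B M by (subst emeasure_distr) auto
  also have "snd -` B \<inter> space M = space X \<times> B"
    using sets.sets_into_space[OF B] by (auto simp: sp)
  also have "emeasure (density M (indicator (A \<times> space Y))) (space X \<times> B) = emeasure M ((A \<times> space Y) \<inter> (space X \<times> B))"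
    using AY by (subst emeasure_density) (auto simp flip: indicator_inter_arith)
  also have "(A \<times> space Y) \<inter> (space X \<times> B) = A \<times> B"
    using sets.sets_into_space[OF A] sets.sets_into_space[OF B] by auto
  finally show ?thesis .
qed

text \<open>
  Otherwise the integrals of \<open>f\<close> and \<open>g\<close> over the set where \<open>g < f\<close> would compare strictly the
  wrong way round.
\<close>
lemma AE_le_if_set_integrals_le:
  fixes f g :: "'a \<Rightarrow> ennreal"
  assumes [measurable]: "f \<in> borel_measurable M" "g \<in> borel_measurable M"
    and fin: "(\<integral>\<^sup>+x. g x \<partial>M) \<noteq> \<infinity>"
    and le: "\<And>B. B \<in> sets M \<Longrightarrow> (\<integral>\<^sup>+x\<in>B. f x \<partial>M) \<le> (\<integral>\<^sup>+x\<in>B. g x \<partial>M)"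
  shows "AE x in M. f x \<le> g x"
proof (rule ccontr)
  assume *: "\<not> (AE x in M. f x \<le> g x)"
  define B where "B = {x\<in>space M. g x < f x}"
  have B[measurable]: "B \<in> sets M" by (simp add: B_def)
  have "(\<integral>\<^sup>+x\<in>B. g x \<partial>M) < (\<integral>\<^sup>+x\<in>B. f x \<partial>M)"
  proof (rule nn_integral_less)
    have "(\<integral>\<^sup>+x\<in>B. g x \<partial>M) \<le> (\<integral>\<^sup>+x. g x \<partial>M)"
      by (intro nn_integral_mono) (auto simp: indicator_def)
    then show "(\<integral>\<^sup>+x\<in>B. g x \<partial>M) \<noteq> \<infinity>" using fin by (auto simp: top_unique)
    show "AE x in M. g x * indicator B x \<le> f x * indicator B x"
      by (auto simp: B_def indicator_def)
    show "\<not> (AE x in M. f x * indicator B x \<le> g x * indicator B x)"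
    proof
      assume "AE x in M. f x * indicator B x \<le> g x * indicator B x"
      then have "AE x in M. f x \<le> g x"
        by (rule AE_mp) (auto simp: B_def indicator_def not_less split: if_splits)
      with * show False by simp
    qed
  qed auto
  with le[OF B] show False by simp
qed

section \<open>Conditional probabilities of a single event\<close>

text \<open>
  \<open>H (y, z)\<close> is a version of the conditional probability of \<open>A\<close> given \<open>y\<close> under \<open>K z\<close>,
  measurable in both arguments at once. The bounds are imposed everywhere, also off the spaces,
  so that no case distinctions are needed when such functions are combined.
\<close>
definition conditional_probability ::
  "'b measure \<Rightarrow> 'c measure \<Rightarrow> ('c \<Rightarrow> ('a \<times> 'b) measure) \<Rightarrow> 'a set \<Rightarrow> ('b \<times> 'c \<Rightarrow> real) \<Rightarrow> bool" where
  "conditional_probability Y Z K A H \<longleftrightarrow>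
     H \<in> borel_measurable (Y \<Otimes>\<^sub>M Z) \<and> (\<forall>p. 0 \<le> H p \<and> H p \<le> 1) \<and>
     (\<forall>z\<in>space Z. \<forall>B\<in>sets Y.
        emeasure (K z) (A \<times> B) = (\<integral>\<^sup>+y\<in>B. ennreal (H (y, z)) \<partial>marginal_snd Y K z))"

text \<open>
  The slice of \<open>M\<close> at \<open>A\<close> is dominated by the marginal, hence has a density, and the density is
  at most 1 almost everywhere. Truncating it at 1 changes it only on a null set.
\<close>
lemma Radon_Nikodym_conditional_probability:
  assumes "prob_space M" and M: "sets M = sets (X \<Otimes>\<^sub>M Y)" and A: "A \<in> sets X"
  shows "\<exists>h\<in>borel_measurable Y. (\<forall>y. 0 \<le> h y \<and> h y \<le> (1::real)) \<and>
    (\<forall>B\<in>sets Y. emeasure M (A \<times> B) = (\<integral>\<^sup>+y\<in>B. ennreal (h y) \<partial>distr M Y snd))"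
proof -
  interpret M: prob_space M by fact
  note M [measurable_cong]
  let ?L = "distr M Y snd"
  interpret L: prob_space ?L by (rule M.prob_space_distr) simp
  let ?N = "slice_measure Y M A"
  have sp: "space M = space X \<times> space Y"
    using sets_eq_imp_space_eq[OF M] by (simp add: space_pair_measure)
  have L: "emeasure ?L B = emeasure M (space X \<times> B)" if B: "B \<in> sets Y" for B
  proof -
    have "snd -` B \<inter> space M = space X \<times> B"
      using sets.sets_into_space[OF B] by (auto simp: sp)
    then show ?thesis using B by (simp add: emeasure_distr)
  qed
  have le: "emeasure ?N B \<le> emeasure ?L B" if B: "B \<in> sets Y" for B
    using B A sets.sets_into_space[OF A]
    by (subst emeasure_slice_measure[OF M A B], subst L[OF B]) (auto intro!: emeasure_mono simp: M)
  have "absolutely_continuous ?L ?N"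
    unfolding absolutely_continuous_def
  proof
    fix B assume "B \<in> null_sets ?L"
    then have "B \<in> sets Y" "emeasure ?L B = 0" by (auto dest: null_setsD1 null_setsD2)
    with le[of B] show "B \<in> null_sets ?N" by (intro null_setsI) auto
  qed
  from L.Radon_Nikodym[OF this] obtain f where f: "f \<in> borel_measurable ?L" "density ?L f = ?N"
    by auto
  from f(1) have [measurable]: "f \<in> borel_measurable Y" by simp
  have fB: "emeasure M (A \<times> B) = (\<integral>\<^sup>+y\<in>B. f y \<partial>?L)" if B: "B \<in> sets Y" for B
    using emeasure_density[OF f(1), of B] B f(2) emeasure_slice_measure[OF M A B] by simp
  have "AE y in ?L. f y \<le> 1"
  proof (rule AE_le_if_set_integrals_le)
    fix B assume B: "B \<in> sets ?L"
    then show "(\<integral>\<^sup>+y\<in>B. f y \<partial>?L) \<le> (\<integral>\<^sup>+y\<in>B. 1 \<partial>?L)"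
      using le[of B] emeasure_slice_measure[OF M A, of B] fB[of B] by simp
  qed (use f L.emeasure_space_1 in auto)
  then have ae: "AE y in ?L. f y = ennreal (min 1 (enn2real (f y)))"
  proof (rule AE_mp, intro AE_I2 impI)
    show "f y = ennreal (min 1 (enn2real (f y)))" if "f y \<le> 1" for y
      using that by (cases "f y") (auto simp: min_def top_unique)
  qed
  show ?thesis
  proof (intro bexI[of _ "\<lambda>y. min 1 (enn2real (f y))"] conjI ballI allI)
    fix B assume B: "B \<in> sets Y"
    show "emeasure M (A \<times> B) = (\<integral>\<^sup>+y\<in>B. ennreal (min 1 (enn2real (f y))) \<partial>?L)"
      unfolding fB[OF B] by (rule nn_integral_cong_AE) (use ae in auto)
  qed auto
qed

text \<open>
  A choice of one density for each \<open>z\<close> is jointly measurable because \<open>Z\<close> is countable with all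
  subsets measurable.
\<close>
lemma conditional_probability_discrete_parameter:
  assumes K: "K \<in> Z \<rightarrow>\<^sub>M prob_algebra (X \<Otimes>\<^sub>M Y)" and A: "A \<in> sets X" and Z: "discrete_space Z"
  shows "\<exists>H. conditional_probability Y Z K A H"
proof -
  have "\<forall>z\<in>space Z. \<exists>h. h \<in> borel_measurable Y \<and> (\<forall>y. 0 \<le> h y \<and> h y \<le> (1::real)) \<and>
    (\<forall>B\<in>sets Y. emeasure (K z) (A \<times> B) = (\<integral>\<^sup>+y\<in>B. ennreal (h y) \<partial>marginal_snd Y K z))"
    using Radon_Nikodym_conditional_probability[OF kernelD(1,2)[OF K] A]
    by (auto simp: marginal_snd_def Bex_def)
  from bchoice[OF this] obtain h where h:
    "\<And>z. z \<in> space Z \<Longrightarrow> h z \<in> borel_measurable Y"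
    "\<And>z y. z \<in> space Z \<Longrightarrow> 0 \<le> h z y \<and> h z y \<le> (1::real)"
    "\<And>z B. z \<in> space Z \<Longrightarrow> B \<in> sets Y \<Longrightarrow>
       emeasure (K z) (A \<times> B) = (\<integral>\<^sup>+y\<in>B. ennreal (h z y) \<partial>marginal_snd Y K z)"
    by blast
  have Zc: "countable (space Z)" "sets Z = sets (count_space (space Z))"
    using Z by (auto simp: discrete_space_def)
  define H where "H = (\<lambda>(y, z). if z \<in> space Z then h z y else 0)"
  have "(\<lambda>p. H p) \<in> borel_measurable (Y \<Otimes>\<^sub>M count_space (space Z))"
    by (rule measurable_compose_countable'[where f="\<lambda>z p. H (fst p, z)" and g=snd and I="space Z", simplified])
       (use h(1) Zc(1) in \<open>auto simp: H_def intro: measurable_compose[OF measurable_fst]\<close>)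
  moreover have "sets (Y \<Otimes>\<^sub>M count_space (space Z)) = sets (Y \<Otimes>\<^sub>M Z)"
    by (rule sets_pair_measure_cong[OF refl]) (use Zc in simp)
  ultimately have "H \<in> borel_measurable (Y \<Otimes>\<^sub>M Z)"
    using measurable_cong_sets by blast
  then show ?thesis
    unfolding conditional_probability_def using h by (intro exI[of _ H]) (auto simp: H_def)
qed

section \<open>Jointly measurable limits\<close>

text \<open>
  The hypothesis \<open>proj\<close> says that \<open>M m - M n\<close> is orthogonal to \<open>M n\<close>. By Pythagoras the squared
  \<open>L2\<close> distance of \<open>M n\<close> and \<open>M m\<close> is then the difference of their squared norms, and a bounded
  increasing sequence of norms is Cauchy.
\<close>
lemma L2_increasing_imp_L1_Cauchy:
  fixes M :: "nat \<Rightarrow> 'b \<Rightarrow> real"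
  assumes L: "prob_space L" and M[measurable]: "\<And>n. M n \<in> borel_measurable L"
    and bounds: "\<And>n y. 0 \<le> M n y" "\<And>n y. M n y \<le> 1"
    and proj: "\<And>n m. n \<le> m \<Longrightarrow> (\<integral>y. M n y * M m y \<partial>L) = (\<integral>y. (M n y)\<^sup>2 \<partial>L)"
    and \<epsilon>: "0 < \<epsilon>"
  shows "\<exists>N. \<forall>m\<ge>N. \<forall>n\<ge>N. (\<integral>\<^sup>+y. ennreal \<bar>M m y - M n y\<bar> \<partial>L) \<le> ennreal \<epsilon>"
proof -
  interpret L: prob_space L by fact
  define a where "a n = (\<integral>y. (M n y)\<^sup>2 \<partial>L)" for n
  have int[simp]: "integrable L (\<lambda>y. M n y * M m y)" "integrable L (\<lambda>y. (M n y)\<^sup>2)" "integrable L (M n)" for n m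
    using bounds by (auto intro!: L.integrable_const_bound[where B=1] mult_le_one power_le_one AE_I2 simp: abs_mult)
  have dist: "(\<integral>y. (M m y - M n y)\<^sup>2 \<partial>L) = a m - a n" if "n \<le> m" for n m
  proof -
    have "(\<integral>y. (M m y - M n y)\<^sup>2 \<partial>L) = (\<integral>y. (M m y)\<^sup>2 - 2 * (M n y * M m y) + (M n y)\<^sup>2 \<partial>L)"
      by (intro Bochner_Integration.integral_cong refl) (simp add: power2_eq_square algebra_simps)
    also have "\<dots> = a m - 2 * (\<integral>y. M n y * M m y \<partial>L) + a n"
      by (simp add: a_def)
    finally show ?thesis using proj[OF that] by (simp add: a_def)
  qed
  have "incseq a"
  proof (rule incseq_SucI)
    fix n
    have "0 \<le> (\<integral>y. (M (Suc n) y - M n y)\<^sup>2 \<partial>L)" by simp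
    then show "a n \<le> a (Suc n)" using dist[of n "Suc n"] by simp
  qed
  moreover have "a n \<le> 1" for n
  proof -
    have "a n \<le> (\<integral>y. 1 \<partial>L)"
      unfolding a_def using bounds by (intro integral_mono) (auto intro!: power_le_one)
    then show ?thesis by (simp add: L.prob_space)
  qed
  ultimately have "convergent a"
    by (metis incseq_convergent convergentI)
  then have "Cauchy a" by (rule convergent_Cauchy)
  then obtain N where N: "\<And>m n. m \<ge> N \<Longrightarrow> n \<ge> N \<Longrightarrow> dist (a m) (a n) < \<epsilon>\<^sup>2"
    using \<epsilon> unfolding Cauchy_def by (metis zero_less_power)
  have less: "(\<integral>\<^sup>+y. ennreal \<bar>M m y - M n y\<bar> \<partial>L) \<le> ennreal \<epsilon>" if "N \<le> n" "n \<le> m" for m n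
  proof -
    have b: "\<bar>M m y - M n y\<bar> \<le> 1" for y using bounds[of m y] bounds[of n y] by linarith
    have i[simp]: "integrable L (\<lambda>y. \<bar>M m y - M n y\<bar>)" "integrable L (\<lambda>y. (M m y - M n y)\<^sup>2)"
      by (auto intro!: L.integrable_const_bound[where B=1] AE_I2 simp: abs_square_le_1 b)
    have "(\<integral>y. \<bar>M m y - M n y\<bar> \<partial>L) \<le> (\<integral>y. (\<epsilon> + (M m y - M n y)\<^sup>2 / \<epsilon>) / 2 \<partial>L)"
    proof (rule integral_mono)
      fix y
      \<comment> \<open>From \<open>L2\<close> to \<open>L1\<close> by the inequality of arithmetic and geometric means: \<open>2 \<epsilon> d \<le> \<epsilon>\<^sup>2 + d\<^sup>2\<close>.\<close>
      have "0 \<le> (\<bar>M m y - M n y\<bar> - \<epsilon>)\<^sup>2" by simp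
      then have "2 * \<epsilon> * \<bar>M m y - M n y\<bar> \<le> \<epsilon>\<^sup>2 + (M m y - M n y)\<^sup>2"
        using power2_diff[of "\<bar>M m y - M n y\<bar>" \<epsilon>] by (simp add: mult.commute mult.left_commute)
      then show "\<bar>M m y - M n y\<bar> \<le> (\<epsilon> + (M m y - M n y)\<^sup>2 / \<epsilon>) / 2"
        using \<epsilon> by (simp add: field_simps power2_eq_square)
    qed (auto)
    also have "\<dots> = (\<epsilon> + (a m - a n) / \<epsilon>) / 2"
      using dist[OF that(2)] by (simp add: L.prob_space)
    also have "\<dots> \<le> (\<epsilon> + \<epsilon>\<^sup>2 / \<epsilon>) / 2"
      using N[of m n] that \<epsilon> by (intro divide_right_mono add_left_mono) (auto simp: dist_real_def)
    also have "\<dots> = \<epsilon>" using \<epsilon> by (simp add: power2_eq_square)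
    finally show ?thesis by (simp add: nn_integral_eq_integral ennreal_leI)
  qed
  have "(\<integral>\<^sup>+y. ennreal \<bar>M m y - M n y\<bar> \<partial>L) \<le> ennreal \<epsilon>" if "N \<le> n" "N \<le> m" for m n
    using less[of n m] less[of m n] that by (cases "n \<le> m") (auto simp: abs_minus_commute)
  then show ?thesis by blast
qed

text \<open>
  A sequence that is Cauchy in \<open>L1 (L z)\<close> for every \<open>z\<close> has an almost surely convergent
  subsequence for every \<open>z\<close>. The indices depend on \<open>z\<close>; choosing each of them as the least one
  that is good enough makes them measurable in \<open>z\<close>, so that the limit is measurable in both
  arguments.
\<close>
lemma measurable_AE_limit_of_kernel_Cauchy:
  fixes M :: "nat \<Rightarrow> 'b \<times> 'c \<Rightarrow> real"
  assumes L: "L \<in> Z \<rightarrow>\<^sub>M prob_algebra Y"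
    and M[measurable]: "\<And>n. M n \<in> borel_measurable (Y \<Otimes>\<^sub>M Z)"
    and Cauchy: "\<And>z \<epsilon>. z \<in> space Z \<Longrightarrow> 0 < \<epsilon> \<Longrightarrow>
      \<exists>N. \<forall>m\<ge>N. \<forall>n\<ge>N. (\<integral>\<^sup>+y. ennreal \<bar>M m (y, z) - M n (y, z)\<bar> \<partial>L z) \<le> ennreal \<epsilon>"
  shows "\<exists>H\<in>borel_measurable (Y \<Otimes>\<^sub>M Z). \<forall>z\<in>space Z. \<exists>r. (\<forall>k::nat. k \<le> r k) \<and>
      (AE y in L z. (\<lambda>k. M (r k) (y, z)) \<longlonglongrightarrow> H (y, z))"
proof -
  note L[THEN measurable_prob_algebraD, measurable]
  define D where "D m n z = (\<integral>\<^sup>+y. ennreal \<bar>M m (y, z) - M n (y, z)\<bar> \<partial>L z)" for m n z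
  have D[measurable]: "D m n \<in> borel_measurable Z" for m n
    unfolding D_def[abs_def]
    by (rule nn_integral_measurable_subprob_algebra2[where N=Y]) measurable
  define ok where "ok k n z \<longleftrightarrow> k \<le> n \<and> (\<forall>m\<ge>n. D m n z \<le> ennreal ((1/2)^k))" for k n z
  have [measurable]: "Measurable.pred Z (ok k n)" for k n
    unfolding ok_def[abs_def] by measurable
  define r where "r k z = (LEAST n. ok k n z)" for k z
  have r[measurable]: "r k \<in> Z \<rightarrow>\<^sub>M count_space UNIV" for k
    unfolding r_def[abs_def] by measurable
  define G where "G k p = M (r k (snd p)) p" for k p
  have [measurable]: "G k \<in> borel_measurable (Y \<Otimes>\<^sub>M Z)" for k
    unfolding G_def[abs_def]
    by (rule measurable_compose_countable[OF M]) measurable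
  have ok_r: "ok k (r k z) z" if z: "z \<in> space Z" for k z
  proof -
    from Cauchy[OF z, of "(1/2)^k"] obtain N where
      N: "\<And>m n. m \<ge> N \<Longrightarrow> n \<ge> N \<Longrightarrow> D m n z \<le> ennreal ((1/2)^k)"
      unfolding D_def by auto
    then have "ok k (max k N) z" by (auto simp: ok_def)
    then show ?thesis unfolding r_def by (rule LeastI)
  qed
  \<comment> \<open>Quality \<open>k + 1\<close> implies quality \<open>k\<close>, so the least indices increase. This matters because \<open>r k z\<close>
  controls the distance to later members of the sequence only.\<close>
  have mono_r: "r k z \<le> r (Suc k) z" if z: "z \<in> space Z" for k z
  proof -
    have "ennreal ((1/2)^Suc k) \<le> ennreal ((1/2)^k)"
      by (intro ennreal_leI power_decreasing) auto
    then have "ok k (r (Suc k) z) z"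
      using ok_r[OF z, of "Suc k"] unfolding ok_def by (auto intro: order_trans)
    then show ?thesis unfolding r_def[of k] by (rule Least_le)
  qed
  have conv: "AE y in L z. (\<lambda>k. M (r k z) (y, z)) \<longlonglongrightarrow> lim (\<lambda>k. G k (y, z))" if z: "z \<in> space Z" for z
  proof -
    have Lz: "sets (L z) = sets Y" by (rule kernelD[OF L z])
    have "(\<lambda>y. M n (y, z)) \<in> borel_measurable Y" for n
      using z by measurable
    then have [measurable]: "(\<lambda>y. M n (y, z)) \<in> borel_measurable (L z)" for n
      by (simp cong: measurable_cong_sets add: Lz)
    \<comment> \<open>Consecutive terms of the subsequence differ by at most \<open>(1/2)^k\<close> in \<open>L1\<close>, so the differences are
    almost surely absolutely summable.\<close>
    have "(\<integral>\<^sup>+y. (\<Sum>k. ennreal \<bar>G (Suc k) (y, z) - G k (y, z)\<bar>) \<partial>L z) =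
        (\<Sum>k. D (r (Suc k) z) (r k z) z)"
      unfolding D_def G_def snd_conv by (rule nn_integral_suminf) simp
    also have "\<dots> \<le> (\<Sum>k. ennreal ((1/2)^k))"
      using ok_r[OF z] mono_r[OF z] by (intro suminf_le) (auto simp: ok_def)
    also have "\<dots> = ennreal (\<Sum>k. (1/2)^k)"
      by (intro suminf_ennreal2) (auto intro: summable_geometric)
    also have "\<dots> < \<infinity>" by simp
    finally have "(\<integral>\<^sup>+y. (\<Sum>k. ennreal \<bar>G (Suc k) (y, z) - G k (y, z)\<bar>) \<partial>L z) \<noteq> \<infinity>" by simp
    then have "AE y in L z. (\<Sum>k. ennreal \<bar>G (Suc k) (y, z) - G k (y, z)\<bar>) \<noteq> \<infinity>"
      by (intro nn_integral_PInf_AE) (auto simp: G_def)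
    then show ?thesis
    proof (rule AE_mp, intro AE_I2 impI)
      fix y assume "(\<Sum>k. ennreal \<bar>G (Suc k) (y, z) - G k (y, z)\<bar>) \<noteq> \<infinity>"
      then have "summable (\<lambda>k. \<bar>G (Suc k) (y, z) - G k (y, z)\<bar>)"
        by (intro summable_suminf_not_top) auto
      then have "summable (\<lambda>k. G (Suc k) (y, z) - G k (y, z))"
        by (rule summable_rabs_cancel)
      then have "convergent (\<lambda>n. \<Sum>k<n. G (Suc k) (y, z) - G k (y, z))"
        by (simp add: summable_iff_convergent)
      then have "convergent (\<lambda>n. G n (y, z) - G 0 (y, z))"
        by (simp only: sum_lessThan_telescope[of "\<lambda>k. G k (y, z)"])
      from convergent_add[OF this convergent_const[of "G 0 (y, z)"]]
      have "convergent (\<lambda>n. G n (y, z))" by simp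
      then have "(\<lambda>k. G k (y, z)) \<longlonglongrightarrow> lim (\<lambda>k. G k (y, z))"
        by (simp add: convergent_LIMSEQ_iff)
      then show "(\<lambda>k. M (r k z) (y, z)) \<longlonglongrightarrow> lim (\<lambda>k. G k (y, z))"
        by (simp add: G_def)
    qed
  qed
  show ?thesis
  proof (intro bexI[of _ "\<lambda>p. lim (\<lambda>k. G k p)"] ballI exI conjI allI)
    fix z k assume z: "z \<in> space Z"
    show "k \<le> r k z" using ok_r[OF z, of k] by (simp add: ok_def)
  qed (use conv in auto)
qed

text \<open>
  The function \<open>q (c y)\<close> averages \<open>g\<close> over the cells of the finite partition induced by \<open>c\<close>; it
  is the conditional expectation of \<open>g\<close> given \<open>c\<close>, so it can replace \<open>g\<close> in integrals against
  functions of \<open>c\<close>. Null cells are harmless: there division by zero gives \<open>q i = 0\<close>, and the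
  integral of \<open>g\<close> is 0 as well.
\<close>
lemma finite_partition_average:
  fixes g :: "'b \<Rightarrow> real" and \<phi> :: "'i \<Rightarrow> real"
  assumes L: "prob_space L" and I: "finite I" and c: "c \<in> L \<rightarrow>\<^sub>M count_space I"
    and g: "integrable L g"
    and q: "\<And>i. i \<in> I \<Longrightarrow> q i = (\<integral>y. indicator {i} (c y) * g y \<partial>L) / measure L {y\<in>space L. c y = i}"
  shows "(\<integral>y. \<phi> (c y) * q (c y) \<partial>L) = (\<integral>y. \<phi> (c y) * g y \<partial>L)"
proof -
  interpret L: prob_space L by fact
  have cm[measurable]: "{y\<in>space L. c y = i} \<in> sets L" if "i \<in> I" for i
    using measurable_sets[OF c, of "{i}"] that by (simp add: vimage_def Int_def conj_commute)
  have ind: "(\<integral>y. indicator {i} (c y) \<partial>L) = measure L {y\<in>space L. c y = i}"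
    "integrable L (\<lambda>y. indicator {i} (c y) :: real)" 
    "integrable L (\<lambda>y. indicator {i} (c y) * g y)" if i: "i \<in> I" for i
  proof -
    have eq: "(indicator {i} (c y) :: real) = indicator {y\<in>space L. c y = i} y" if "y \<in> space L" for y
      using that by (auto simp: indicator_def)
    show "integrable L (\<lambda>y. indicator {i} (c y) :: real)"
      using cm[OF i] by (subst Bochner_Integration.integrable_cong[OF refl eq]) (auto simp: L.emeasure_eq_measure)
    show "(\<integral>y. indicator {i} (c y) \<partial>L) = measure L {y\<in>space L. c y = i}"
      using cm[OF i] by (subst Bochner_Integration.integral_cong[OF refl eq]) auto
    show "integrable L (\<lambda>y. indicator {i} (c y) * g y)"
      using integrable_mult_indicator[OF cm[OF i] g]
      by (subst Bochner_Integration.integrable_cong[OF refl, where g="\<lambda>y. indicator {y\<in>space L. c y = i} y *\<^sub>R g y"])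
         (auto simp: eq)
  qed
  have zero: "(\<integral>y. indicator {i} (c y) * g y \<partial>L) = 0"
    if i: "i \<in> I" and 0: "measure L {y\<in>space L. c y = i} = 0" for i
  proof -
    have "AE y in L. c y \<noteq> i"
      using L.prob_eq_0[OF cm[OF i]] 0 by auto
    then have "(\<integral>y. indicator {i} (c y) * g y \<partial>L) = (\<integral>y. 0 \<partial>L)"
      by (intro integral_cong_AE borel_measurable_integrable[OF ind(3)[OF i]]) auto
    then show ?thesis by simp
  qed
  have dec: "\<psi> (c y) * h y = (\<Sum>i\<in>I. \<psi> i * (indicator {i} (c y) * h y))"
    if y: "y \<in> space L" for \<psi> h :: "_ \<Rightarrow> real" and y
  proof -
    have "(\<Sum>i\<in>I. \<psi> i * (indicator {i} (c y) * h y)) = (\<Sum>i\<in>I. if i = c y then \<psi> i * h y else 0)"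
      by (intro sum.cong) (auto simp: indicator_def)
    then show ?thesis
      using I measurable_space[OF c y] by (simp add: sum.delta')
  qed
  have "(\<integral>y. \<phi> (c y) * q (c y) \<partial>L) = (\<integral>y. (\<Sum>i\<in>I. (\<phi> i * q i) * (indicator {i} (c y) * 1)) \<partial>L)"
    by (intro Bochner_Integration.integral_cong refl) (subst dec[symmetric], auto)
  also have "\<dots> = (\<Sum>i\<in>I. \<phi> i * (q i * measure L {y\<in>space L. c y = i}))"
    using ind by (subst Bochner_Integration.integral_sum) (auto simp: mult.assoc)
  also have "\<dots> = (\<Sum>i\<in>I. \<phi> i * (\<integral>y. indicator {i} (c y) * g y \<partial>L))"
    using zero by (intro sum.cong refl) (auto simp: q)
  also have "\<dots> = (\<integral>y. (\<Sum>i\<in>I. \<phi> i * (indicator {i} (c y) * g y)) \<partial>L)"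
    using ind by (subst Bochner_Integration.integral_sum) auto
  also have "\<dots> = (\<integral>y. \<phi> (c y) * g y \<partial>L)"
    by (intro Bochner_Integration.integral_cong refl dec[symmetric])
  finally show ?thesis .
qed

section \<open>Conditional probabilities for a countably generated conditioning space\<close>

text \<open>
  The cell of \<open>y\<close> in the partition generated by \<open>E 0, \<dots>, E (n - 1)\<close>, named by the indices
  of the sets that contain \<open>y\<close>. A set is a finite union of such cells iff membership in it is
  decided by this code.
\<close>
definition initial_code :: "(nat \<Rightarrow> 'b set) \<Rightarrow> nat \<Rightarrow> 'b \<Rightarrow> nat set" where
  "initial_code E n y = {i. i < n \<and> y \<in> E i}"

lemma initial_code_Int: "n \<le> m \<Longrightarrow> initial_code E n y = initial_code E m y \<inter> {..<n}"
  by (auto simp: initial_code_def)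

lemma measurable_initial_code:
  assumes [measurable]: "\<And>i. E i \<in> sets Y"
  shows "initial_code E n \<in> Y \<rightarrow>\<^sub>M count_space (Pow {..<n})"
proof (subst measurable_count_space_eq2, simp, intro conjI ballI)
  show "initial_code E n \<in> space Y \<rightarrow> Pow {..<n}" by (auto simp: initial_code_def)
  fix S
  have "{y\<in>space Y. i \<in> S \<longleftrightarrow> i < n \<and> y \<in> E i} \<in> sets Y" for i
    by (cases "i \<in> S"; cases "i < n") auto
  then have "{y\<in>space Y. \<forall>i. i \<in> S \<longleftrightarrow> i < n \<and> y \<in> E i} \<in> sets Y"
    by (rule sets.sets_Collect_countable_All)
  also have "{y\<in>space Y. \<forall>i. i \<in> S \<longleftrightarrow> i < n \<and> y \<in> E i} = initial_code E n -` {S} \<inter> space Y"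
    unfolding initial_code_def by blast
  finally show "initial_code E n -` {S} \<inter> space Y \<in> sets Y" .
qed

lemma sets_eq_sigma_sets_initial_code:
  assumes E: "\<And>i. E i \<in> sets Y" and gen: "sets Y = sigma_sets (space Y) (range E)"
  shows "sets Y = sigma_sets (space Y) {{y\<in>space Y. initial_code E n y \<in> T} |n T. True}"
    (is "_ = sigma_sets _ ?G")
proof
  show "sets Y \<subseteq> sigma_sets (space Y) ?G"
    unfolding gen
  proof (rule sigma_sets_mono, safe)
    fix i
    have "E i = {y\<in>space Y. initial_code E (Suc i) y \<in> {S. i \<in> S}}"
      using sets.sets_into_space[OF E[of i]] by (auto simp: initial_code_def)
    then show "E i \<in> sigma_sets (space Y) ?G" by (intro sigma_sets.Basic) blast
  qed
  show "sigma_sets (space Y) ?G \<subseteq> sets Y"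
  proof (rule sets.sigma_sets_subset, safe)
    fix n T
    have "(\<lambda>y. initial_code E n y \<in> T) \<in> Y \<rightarrow>\<^sub>M count_space UNIV"
      using measurable_compose[OF measurable_initial_code[of E Y n, OF E], of "\<lambda>S. S \<in> T"] by simp
    then show "{y\<in>space Y. initial_code E n y \<in> T} \<in> sets Y" by measurable
  qed
qed

lemma Int_stable_initial_code:
  "Int_stable {{y\<in>space Y. initial_code E n y \<in> T} |n T. True}"
proof (rule Int_stableI)
  fix a b assume "a \<in> {{y\<in>space Y. initial_code E n y \<in> T} |n T. True}"
    and "b \<in> {{y\<in>space Y. initial_code E n y \<in> T} |n T. True}"
  then obtain n m S T where ab: "a = {y\<in>space Y. initial_code E n y \<in> S}"
    "b = {y\<in>space Y. initial_code E m y \<in> T}" by blast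
  let ?k = "max n m"
  have "a \<inter> b = {y\<in>space Y. initial_code E ?k y \<in> {U. U \<inter> {..<n} \<in> S \<and> U \<inter> {..<m} \<in> T}}"
    by (auto simp: ab initial_code_Int[of n ?k E, symmetric] initial_code_Int[of m ?k E, symmetric])
  then show "a \<inter> b \<in> {{y\<in>space Y. initial_code E n y \<in> T} |n T. True}" by blast
qed

text \<open>
  The ratios \<open>q\<close> over the cells of the \<open>n\<close>-th partition are measurable in \<open>z\<close> because \<open>K z\<close> and
  \<open>L z\<close> are kernels. By \<open>finite_partition_average\<close> they are conditional expectations of a
  density \<open>g\<close> for each fixed \<open>z\<close>. This density is chosen separately for each \<open>z\<close>, without any
  measurability in \<open>z\<close>; it identifies the set integrals of the limit, while the joint
  measurability of the limit comes from the ratios.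
\<close>
lemma conditional_probability_countably_generated:
  assumes K: "K \<in> Z \<rightarrow>\<^sub>M prob_algebra (X \<Otimes>\<^sub>M Y)" and A: "A \<in> sets X"
    and Y: "countably_generated_space Y"
  shows "\<exists>H. conditional_probability Y Z K A H"
proof -
  from Y obtain \<E> where \<E>: "countable \<E>" "\<E> \<subseteq> Pow (space Y)" "sets Y = sigma_sets (space Y) \<E>"
    unfolding countably_generated_space_def by blast
  \<comment> \<open>The whole space is added to the generators because an enumeration needs a nonempty range.\<close>
  define E where "E = from_nat_into (insert (space Y) \<E>)"
  have rangeE: "range E = insert (space Y) \<E>"
    unfolding E_def using \<E>(1) by (intro range_from_nat_into) auto
  have E[measurable]: "E i \<in> sets Y" for i
    using rangeE \<E>(3) by (metis insertE rangeI sets.top sigma_sets.Basic)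
  have gen: "sets Y = sigma_sets (space Y) (range E)"
  proof
    show "sets Y \<subseteq> sigma_sets (space Y) (range E)"
      unfolding \<E>(3) rangeE by (intro sigma_sets_mono') auto
    show "sigma_sets (space Y) (range E) \<subseteq> sets Y" 
      by (intro sets.sigma_sets_subset) auto
  qed
  let ?c = "initial_code E"
  note c = measurable_initial_code[of E Y, OF E]
  have c_in: "(\<lambda>y. \<phi> (?c n y)) \<in> Y \<rightarrow>\<^sub>M N" if "\<And>S. \<phi> S \<in> space N" for \<phi> and N :: "'z measure" and n
    by (rule measurable_compose[OF c]) (use that in auto)
  note L = marginal_snd_kernel[OF K]
  let ?L = "marginal_snd Y K"
  define cell where "cell n S = {y\<in>space Y. ?c n y = S}" for n S
  have cell[measurable]: "cell n S \<in> sets Y" for n S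
  proof -
    have "(\<lambda>y. ?c n y = S) \<in> Y \<rightarrow>\<^sub>M count_space UNIV" by (rule c_in) simp
    then show ?thesis unfolding cell_def by measurable
  qed
  define q where "q n z S = measure (K z) (A \<times> cell n S) / measure (?L z) (cell n S)" for n z S
  \<comment> \<open>For \<open>z\<close> in the space of \<open>Z\<close> the ratio already lies in \<open>[0, 1]\<close>; the truncation extends the bounds to all
  arguments.\<close>
  define M where "M n p = (case p of (y, z) \<Rightarrow> min 1 (max 0 (q n z (?c n y))))" for n p
  have q_meas: "(\<lambda>z. q n z S) \<in> borel_measurable Z" for n S
  proof -
    have "(\<lambda>z. emeasure (K z) (A \<times> cell n S)) \<in> borel_measurable Z"
      "(\<lambda>z. emeasure (?L z) (cell n S)) \<in> borel_measurable Z"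
      using K L A cell[of n S] by (simp_all add: markov_kernel_iff)
    then show ?thesis unfolding q_def measure_def by measurable
  qed
  have M_meas[measurable]: "M n \<in> borel_measurable (Y \<Otimes>\<^sub>M Z)" for n
  proof -
    have "(\<lambda>p. q n (snd p) (?c n (fst p))) \<in> borel_measurable (Y \<Otimes>\<^sub>M Z)"
      by (rule measurable_compose_countable'[where I="Pow {..<n}"])
         (auto intro!: measurable_compose[OF measurable_snd q_meas] measurable_compose[OF measurable_fst c] countable_finite)
    then show ?thesis unfolding M_def[abs_def] case_prod_beta' by measurable
  qed
  have M_bounds: "0 \<le> M n p" "M n p \<le> 1" for n p
    by (auto simp: M_def split: prod.split)
  have key: "\<exists>g\<in>borel_measurable Y. (\<forall>y. 0 \<le> g y \<and> g y \<le> (1::real)) \<and>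
     (\<forall>B\<in>sets Y. emeasure (K z) (A \<times> B) = (\<integral>\<^sup>+y\<in>B. ennreal (g y) \<partial>?L z)) \<and>
     (\<forall>n \<phi>. (\<integral>y. \<phi> (?c n y) * M n (y, z) \<partial>?L z) = (\<integral>y. \<phi> (?c n y) * g y \<partial>?L z))"
    if z: "z \<in> space Z" for z
  proof -
    interpret Lz: prob_space "?L z" by (rule kernelD[OF L z])
    have Ls: "sets (?L z) = sets Y" "space (?L z) = space Y" using kernelD[OF L z] by auto
    from Radon_Nikodym_conditional_probability[OF kernelD(1,2)[OF K z] A] obtain g where
      g[measurable]: "g \<in> borel_measurable Y" and gb: "\<And>y. 0 \<le> g y" "\<And>y. g y \<le> (1::real)" and
      gB: "\<And>B. B \<in> sets Y \<Longrightarrow> emeasure (K z) (A \<times> B) = (\<integral>\<^sup>+y\<in>B. ennreal (g y) \<partial>?L z)"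
      unfolding marginal_snd_def by blast
    have gL: "g \<in> borel_measurable (?L z)" using g by (simp cong: measurable_cong_sets add: Ls)
    have gi: "integrable (?L z) g"
      using gb gL by (intro Lz.integrable_const_bound[where B=1]) auto
    have gE: "measure (K z) (A \<times> B) = (\<integral>y. indicator B y * g y \<partial>?L z)" if B: "B \<in> sets Y" for B
    proof -
      have "(\<integral>y. indicator B y * g y \<partial>?L z) = enn2real (\<integral>\<^sup>+y. ennreal (indicator B y * g y) \<partial>?L z)"
        using gL B gb Ls by (intro integral_eq_nn_integral) auto
      also have "(\<integral>\<^sup>+y. ennreal (indicator B y * g y) \<partial>?L z) = emeasure (K z) (A \<times> B)"
        unfolding gB[OF B] by (intro nn_integral_cong) (auto simp: indicator_def)
      finally show ?thesis by (simp add: measure_def)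
    qed
    have q_eq: "q n z S = (\<integral>y. indicator {S} (?c n y) * g y \<partial>?L z) / measure (?L z) {y\<in>space (?L z). ?c n y = S}" for n S
    proof -
      have "(\<integral>y. indicator {S} (?c n y) * g y \<partial>?L z) = measure (K z) (A \<times> cell n S)"
        unfolding gE[OF cell] 
        by (intro Bochner_Integration.integral_cong refl) (auto simp: cell_def indicator_def Ls)
      then show ?thesis by (simp add: q_def cell_def Ls)
    qed
    have q01: "0 \<le> q n z S" "q n z S \<le> 1" for n S
    proof -
      show "0 \<le> q n z S" by (simp add: q_def)
      have "measure (K z) (A \<times> cell n S) \<le> (\<integral>y. indicator (cell n S) y \<partial>?L z)"
        unfolding gE[OF cell] using gb gi cell[of n S] gL Ls
        by (intro integral_mono Lz.integrable_const_bound[where B=1]) (auto simp: indicator_def)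
      also have "\<dots> = measure (?L z) (cell n S)"
        using cell[of n S] by (simp add: Ls)
      finally show "q n z S \<le> 1" by (simp add: q_def divide_le_eq_1 zero_less_measure_iff)
    qed
    have Mq: "M n (y, z) = q n z (?c n y)" for n y
      using q01[of n "?c n y"] by (simp add: M_def)
    have "(\<integral>y. \<phi> (?c n y) * M n (y, z) \<partial>?L z) = (\<integral>y. \<phi> (?c n y) * g y \<partial>?L z)" for n \<phi>
      unfolding Mq
      by (rule finite_partition_average[where I="Pow {..<n}"])
         (use gi q_eq c[of n] Ls Lz.prob_space_axioms in \<open>auto cong: measurable_cong_sets\<close>)
    with g gb gB show ?thesis by blast
  qed
  have "\<exists>H\<in>borel_measurable (Y \<Otimes>\<^sub>M Z). \<forall>z\<in>space Z. \<exists>r. (\<forall>k::nat. k \<le> r k) \<and>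
      (AE y in ?L z. (\<lambda>k. M (r k) (y, z)) \<longlonglongrightarrow> H (y, z))"
  proof (rule measurable_AE_limit_of_kernel_Cauchy[OF L M_meas])
    fix z \<epsilon> assume z: "z \<in> space Z" and \<epsilon>: "0 < (\<epsilon>::real)"
    from key[OF z] obtain g where
      g: "\<And>n \<phi>. (\<integral>y. \<phi> (?c n y) * M n (y, z) \<partial>?L z) = (\<integral>y. \<phi> (?c n y) * g y \<partial>?L z)" by blast
    have Mq: "M n (y, z) = min 1 (max 0 (q n z (?c n y)))" for n y by (simp add: M_def)
    show "\<exists>N. \<forall>m\<ge>N. \<forall>n\<ge>N. (\<integral>\<^sup>+y. ennreal \<bar>M m (y, z) - M n (y, z)\<bar> \<partial>?L z) \<le> ennreal \<epsilon>"
    proof (rule L2_increasing_imp_L1_Cauchy[OF kernelD(1)[OF L z] _ M_bounds _ \<epsilon>])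
      show "(\<lambda>y. M n (y, z)) \<in> borel_measurable (?L z)" for n
        using z by (subst measurable_cong_sets[OF kernelD(2)[OF L z] refl]) measurable
      fix n m :: nat assume nm: "n \<le> m"
      let ?\<phi> = "\<lambda>S. min 1 (max 0 (q n z S))"
      have "(\<integral>y. M n (y, z) * M m (y, z) \<partial>?L z) = (\<integral>y. ?\<phi> (?c m y \<inter> {..<n}) * M m (y, z) \<partial>?L z)"
        by (simp add: Mq[of n] initial_code_Int[OF nm, symmetric])
      also have "\<dots> = (\<integral>y. ?\<phi> (?c n y) * g y \<partial>?L z)"
        by (subst g[of "\<lambda>S. ?\<phi> (S \<inter> {..<n})" m]) (simp add: initial_code_Int[OF nm, symmetric])
      also have "\<dots> = (\<integral>y. ?\<phi> (?c n y) * M n (y, z) \<partial>?L z)"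
        by (rule g[symmetric])
      also have "\<dots> = (\<integral>y. (M n (y, z))\<^sup>2 \<partial>?L z)"
        by (simp add: Mq power2_eq_square)
      finally show "(\<integral>y. M n (y, z) * M m (y, z) \<partial>?L z) = (\<integral>y. (M n (y, z))\<^sup>2 \<partial>?L z)" .
    qed
  qed
  then obtain H0 where H0[measurable]: "H0 \<in> borel_measurable (Y \<Otimes>\<^sub>M Z)" and
    lim0: "\<And>z. z \<in> space Z \<Longrightarrow> \<exists>r. (\<forall>k::nat. k \<le> r k) \<and>
      (AE y in ?L z. (\<lambda>k. M (r k) (y, z)) \<longlonglongrightarrow> H0 (y, z))" by blast
  define H where "H p = max 0 (min 1 (H0 p))" for p
  have H[measurable]: "H \<in> borel_measurable (Y \<Otimes>\<^sub>M Z)" unfolding H_def[abs_def] by measurable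
  have Hb: "0 \<le> H p" "H p \<le> 1" for p by (auto simp: H_def)
  have "emeasure (K z) (A \<times> B) = (\<integral>\<^sup>+y\<in>B. ennreal (H (y, z)) \<partial>?L z)"
    if z: "z \<in> space Z" and B: "B \<in> sets Y" for z B
  proof -
    interpret Lz: prob_space "?L z" by (rule kernelD[OF L z])
    have Ls: "sets (?L z) = sets Y" "space (?L z) = space Y" using kernelD[OF L z] by auto
    from key[OF z] obtain g where
      g: "g \<in> borel_measurable Y" "\<And>y. 0 \<le> g y" "\<And>y. g y \<le> 1"
        "\<And>B. B \<in> sets Y \<Longrightarrow> emeasure (K z) (A \<times> B) = (\<integral>\<^sup>+y\<in>B. ennreal (g y) \<partial>?L z)"
        "\<And>n \<phi>. (\<integral>y. \<phi> (?c n y) * M n (y, z) \<partial>?L z) = (\<integral>y. \<phi> (?c n y) * g y \<partial>?L z)" by blast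
    from lim0[OF z] obtain r where r: "\<And>k. k \<le> r k"
      and r0: "AE y in ?L z. (\<lambda>k. M (r k) (y, z)) \<longlonglongrightarrow> H0 (y, z)" by blast
    from r0 have lim: "AE y in ?L z. (\<lambda>k. M (r k) (y, z)) \<longlonglongrightarrow> H (y, z)"
    proof (rule AE_mp[OF _ AE_I2], intro impI)
      fix y assume l: "(\<lambda>k. M (r k) (y, z)) \<longlonglongrightarrow> H0 (y, z)"
      have "0 \<le> H0 (y, z)" "H0 (y, z) \<le> 1"
        using LIMSEQ_le_const[OF l, of 0] LIMSEQ_le_const2[OF l, of 1] M_bounds by auto
      with l show "(\<lambda>k. M (r k) (y, z)) \<longlonglongrightarrow> H (y, z)" by (simp add: H_def)
    qed
    have [measurable]: "(\<lambda>y. M n (y, z)) \<in> borel_measurable (?L z)" "(\<lambda>y. H (y, z)) \<in> borel_measurable (?L z)"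
      "g \<in> borel_measurable (?L z)" for n
      using z g(1) by (simp_all cong: measurable_cong_sets add: Ls)
    \<comment> \<open>It remains to see that \<open>H\<close> has the same set integrals as \<open>g\<close>. On a set determined by the first
    \<open>n\<close> generators the integrals of \<open>M m\<close> and \<open>g\<close> agree for \<open>m \<ge> n\<close>, and dominated convergence passes to the limit.\<close>
    let ?H = "density (?L z) (\<lambda>y. ennreal (H (y, z)))" and ?g = "density (?L z) (\<lambda>y. ennreal (g y))"
    have "?g = ?H"
    proof (rule measure_eqI_generator_eq[OF Int_stable_initial_code[of Y E], where \<Omega>="space Y" and A="\<lambda>_. space Y"])
      show "sets ?g = sigma_sets (space Y) {{y\<in>space Y. ?c n y \<in> T} |n T. True}"
        "sets ?H = sigma_sets (space Y) {{y\<in>space Y. ?c n y \<in> T} |n T. True}"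
        using sets_eq_sigma_sets_initial_code[OF E gen] Ls by simp_all
      have "space Y = {y\<in>space Y. ?c 0 y \<in> UNIV}" by auto
      then show "range (\<lambda>i::nat. space Y) \<subseteq> {{y\<in>space Y. ?c n y \<in> T} |n T. True}" by blast
      show "emeasure ?g (space Y) \<noteq> \<infinity>"
        using finite_measure.emeasure_finite[OF prob_space.finite_measure[OF kernelD(1)[OF K z]], of "A \<times> space Y"] Ls
        by (simp add: emeasure_density g(4))
      fix D assume "D \<in> {{y\<in>space Y. ?c n y \<in> T} |n T. True}"
      then obtain n T where D: "D = {y\<in>space Y. ?c n y \<in> T}" by blast
      then have [measurable]: "D \<in> sets (?L z)"
        using Ls sets_eq_sigma_sets_initial_code[OF E gen] by (auto intro: sigma_sets.Basic)
      have int_k: "(\<integral>y. indicator D y * M m (y, z) \<partial>?L z) = (\<integral>y. indicator D y * g y \<partial>?L z)" if "n \<le> m" for m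
      proof -
        have "(\<integral>y. indicator D y * M m (y, z) \<partial>?L z) = (\<integral>y. indicator {S. S \<inter> {..<n} \<in> T} (?c m y) * M m (y, z) \<partial>?L z)"
          by (intro Bochner_Integration.integral_cong refl)
             (auto simp: D Ls initial_code_Int[OF that, symmetric] indicator_def)
        also have "\<dots> = (\<integral>y. indicator {S. S \<inter> {..<n} \<in> T} (?c m y) * g y \<partial>?L z)"
          by (rule g(5))
        also have "\<dots> = (\<integral>y. indicator D y * g y \<partial>?L z)"
          by (intro Bochner_Integration.integral_cong refl)
             (auto simp: D Ls initial_code_Int[OF that, symmetric] indicator_def)
        finally show ?thesis .
      qed
      have "(\<lambda>k. \<integral>y. indicator D y * M (r k) (y, z) \<partial>?L z) \<longlonglongrightarrow> (\<integral>y. indicator D y * H (y, z) \<partial>?L z)"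
      proof (rule integral_dominated_convergence[where w="\<lambda>_. 1"])
        show "AE y in ?L z. (\<lambda>k. indicator D y * M (r k) (y, z)) \<longlonglongrightarrow> indicator D y * H (y, z)"
          using lim by (rule AE_mp) (auto intro!: AE_I2 tendsto_intros)
        show "AE y in ?L z. norm (indicator D y * M (r k) (y, z)) \<le> 1" for k
          using M_bounds by (auto simp: indicator_def)
      qed auto
      moreover have "(\<lambda>k. \<integral>y. indicator D y * M (r k) (y, z) \<partial>?L z) \<longlonglongrightarrow> (\<integral>y. indicator D y * g y \<partial>?L z)"
      proof (rule tendsto_eventually, rule eventually_sequentiallyI[of n])
        show "(\<integral>y. indicator D y * M (r k) (y, z) \<partial>?L z) = (\<integral>y. indicator D y * g y \<partial>?L z)" if "n \<le> k" for k
          using that r[of k] by (intro int_k) simp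
      qed
      ultimately have eq: "(\<integral>y. indicator D y * H (y, z) \<partial>?L z) = (\<integral>y. indicator D y * g y \<partial>?L z)"
        by (rule LIMSEQ_unique)
      have to_int: "emeasure (density (?L z) (\<lambda>y. ennreal (h y))) D = ennreal (\<integral>y. indicator D y * h y \<partial>?L z)"
        if [measurable]: "h \<in> borel_measurable (?L z)" and h: "\<And>y. 0 \<le> h y" "\<And>y. h y \<le> 1" for h :: "_ \<Rightarrow> real"
      proof -
        have "emeasure (density (?L z) (\<lambda>y. ennreal (h y))) D = (\<integral>\<^sup>+y. ennreal (indicator D y * h y) \<partial>?L z)"
          by (subst emeasure_density) (auto intro!: nn_integral_cong simp: indicator_def)
        also have "\<dots> = ennreal (\<integral>y. indicator D y * h y \<partial>?L z)"
          using h by (intro nn_integral_eq_integral Lz.integrable_const_bound[where B=1])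
            (auto simp: indicator_def)
        finally show ?thesis .
      qed
      show "emeasure ?g D = emeasure ?H D"
        using eq by (simp add: to_int g Hb)
    qed auto
    then have "emeasure ?g B = emeasure ?H B" by simp
    then show ?thesis
      using g(4)[OF B] B Ls by (simp add: emeasure_density)
  qed
  then show ?thesis unfolding conditional_probability_def using H Hb by blast
qed

section \<open>From conditional probabilities to a kernel on the unit interval\<close>

text \<open>
  The generalized inverse of a distribution function that is known at rational points only. The
  function \<open>h\<close> will be monotone only almost surely. If \<open>h\<close> has values in \<open>[0, 1]\<close>, is 0 at
  negative arguments and is 1 from 1 on, and \<open>u\<close> is uniform on \<open>(0, 1)\<close>, then the quantile is
  below \<open>t\<close> with probability the supremum of \<open>h\<close> over the rationals below \<open>t\<close>, monotone or not.
\<close>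
definition rat_quantile :: "(rat \<Rightarrow> real) \<Rightarrow> real \<Rightarrow> real" where
  "rat_quantile h u = Inf (of_rat ` {r. u \<le> h r})"

lemma rat_quantile_less_iff:
  assumes "\<And>r. r < 0 \<Longrightarrow> h r = 0" "\<And>r. 1 \<le> r \<Longrightarrow> h r = 1" and u: "0 < u" "u < 1"
  shows "rat_quantile h u < t \<longleftrightarrow> (\<exists>r. of_rat r < t \<and> u \<le> h r)"
proof -
  have "u \<le> h 1" using assms(2)[of 1] u by simp
  then have "of_rat ` {r. u \<le> h r} \<noteq> ({} :: real set)" by blast
  moreover have "bdd_below (of_rat ` {r. u \<le> h r} :: real set)"
  proof (rule bdd_belowI2)
    fix r assume "r \<in> {r. u \<le> h r}"
    then have "0 \<le> r" using assms(1)[of r] u by (cases "r < 0") auto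
    then show "0 \<le> (of_rat r :: real)" by simp
  qed
  ultimately show ?thesis
    unfolding rat_quantile_def by (subst cInf_less_iff) auto
qed

abbreviation uniform01 :: "real measure" where
  "uniform01 \<equiv> restrict_space lborel {0<..<1}"

lemma prob_space_uniform01: "prob_space uniform01"
  by (rule prob_spaceI) (simp add: emeasure_restrict_space space_restrict_space)

lemma emeasure_uniform01_below_Sup:
  fixes h :: "'i::countable \<Rightarrow> real"
  assumes R: "R \<noteq> {}" and h: "\<And>r. 0 \<le> h r" "\<And>r. h r \<le> 1"
  shows "emeasure uniform01 {u\<in>{0<..<1}. \<exists>r\<in>R. u \<le> h r} = (SUP r\<in>R. ennreal (h r))"
proof -
  have [measurable]: "{u\<in>{0<..<1}. \<exists>r\<in>R. u \<le> h r} \<in> sets borel"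
  proof -
    have "{u\<in>{0<..<1}. \<exists>r\<in>R. u \<le> h r} = (\<Union>r\<in>R. {0<..<1} \<inter> {..h r})" by auto
    also have "\<dots> \<in> sets borel"
      by (rule sets.countable_UN'') auto
    finally show ?thesis .
  qed
  have le1: "(SUP r\<in>R. ennreal (h r)) \<le> 1"
    using h by (intro SUP_least) simp
  define s where "s = enn2real (SUP r\<in>R. ennreal (h r))"
  have s: "ennreal s = (SUP r\<in>R. ennreal (h r))" "0 \<le> s"
    using le1 by (auto simp: s_def intro!: ennreal_enn2real le_less_trans[OF le1])
  have hs: "h r \<le> s" if "r \<in> R" for r
  proof -
    have "ennreal (h r) \<le> ennreal s" unfolding s(1) by (rule SUP_upper[OF that])
    then show ?thesis using s(2) by simp
  qed
  have "emeasure uniform01 {u\<in>{0<..<1}. \<exists>r\<in>R. u \<le> h r} = emeasure lborel {u\<in>{0<..<1}. \<exists>r\<in>R. u \<le> h r}"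
    by (rule emeasure_restrict_space) auto
  also have "\<dots> = (SUP r\<in>R. ennreal (h r))"
  proof (rule antisym)
    have "{u\<in>{0<..<1}. \<exists>r\<in>R. u \<le> h r} \<subseteq> {0<..s}"
      using hs by force
    then have "emeasure lborel {u\<in>{0<..<1}. \<exists>r\<in>R. u \<le> h r} \<le> emeasure lborel {0<..s}"
      by (intro emeasure_mono) auto
    then show "emeasure lborel {u\<in>{0<..<1}. \<exists>r\<in>R. u \<le> h r} \<le> (SUP r\<in>R. ennreal (h r))"
      using s by simp
    show "(SUP r\<in>R. ennreal (h r)) \<le> emeasure lborel {u\<in>{0<..<1}. \<exists>r\<in>R. u \<le> h r}"
    proof (rule SUP_least)
      fix r assume r: "r \<in> R"
      have "{0<..<h r} \<subseteq> {u\<in>{0<..<1}. \<exists>r\<in>R. u \<le> h r}"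
        using r h(2)[of r] by force
      then have "emeasure lborel {0<..<h r} \<le> emeasure lborel {u\<in>{0<..<1}. \<exists>r\<in>R. u \<le> h r}"
        by (intro emeasure_mono) auto
      then show "ennreal (h r) \<le> emeasure lborel {u\<in>{0<..<1}. \<exists>r\<in>R. u \<le> h r}"
        using h(1)[of r] by simp
    qed
  qed
  finally show ?thesis .
qed

text \<open>
  Take the running maxima of an enumeration of the rationals below \<open>t\<close>.
\<close>
lemma ex_increasing_rats_below:
  fixes t :: real
  shows "\<exists>r :: nat \<Rightarrow> rat. incseq r \<and> (\<forall>n. of_rat (r n) < t) \<and> (\<forall>s. of_rat s < t \<longrightarrow> (\<exists>n. s \<le> r n))"
proof -
  let ?R = "{s :: rat. of_rat s < t}"
  have "?R \<noteq> {}" using of_rat_dense[of "t - 1" t] by auto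
  then have e: "range (from_nat_into ?R) = ?R" by (intro range_from_nat_into) auto
  define r where "r n = Max (from_nat_into ?R ` {..n})" for n
  have "incseq r" unfolding r_def by (intro incseq_SucI Max_mono) auto
  moreover have "of_rat (r n) < t" for n
  proof -
    have "r n \<in> from_nat_into ?R ` {..n}" unfolding r_def by (intro Max_in) auto
    then have "r n \<in> ?R" using e by blast
    then show ?thesis by simp
  qed
  moreover have "\<exists>n. s \<le> r n" if "of_rat s < t" for s
  proof -
    from that obtain n where "s = from_nat_into ?R n" using e by (metis (mono_tags, lifting) imageE mem_Collect_eq)
    then have "s \<le> r n" unfolding r_def by (intro Max_ge) auto
    then show ?thesis ..
  qed
  ultimately show ?thesis by blast
qed

text \<open>
  Half-lines times measurable sets form a \<open>\<pi>\<close>-system that generates the product with the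
  real line. Open half-lines are the right choice because the quantile is below \<open>t\<close> iff some
  rational below \<open>t\<close> witnesses it.
\<close>
lemma real_product_measure_eqI:
  fixes M N :: "(real \<times> 'b) measure"
  assumes M: "sets M = sets (borel \<Otimes>\<^sub>M Y)" and N: "sets N = sets (borel \<Otimes>\<^sub>M Y)"
    and fin: "finite_measure M"
    and eq: "\<And>t B. B \<in> sets Y \<Longrightarrow> emeasure M ({..<t} \<times> B) = emeasure N ({..<t} \<times> B)"
  shows "M = N"
proof -
  let ?E = "{a \<times> b |a b. a \<in> range (\<lambda>t::real. {..<t}) \<and> b \<in> sets Y}"
  have "sets ((borel::real measure) \<Otimes>\<^sub>M Y) =
      sets (sigma (space (borel::real measure) \<times> space Y) ?E)"
  proof (rule sets_pair_eq[where Ca="range (\<lambda>n::nat. {..<real n})" and Cb="{space Y}"])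
    show "sets (borel::real measure) = sigma_sets (space borel) (range (\<lambda>t::real. {..<t}))"
      by (subst borel_Iio) simp
    show "\<Union> (range (\<lambda>n::nat. {..<real n})) = space (borel::real measure)"
      using reals_Archimedean2 by auto
  qed (auto simp: sets.sigma_sets_eq sets.space_closed)
  then have gen: "sets ((borel::real measure) \<Otimes>\<^sub>M Y) = sigma_sets (UNIV \<times> space Y) ?E"
    using sets.sets_into_space[of _ Y] by (subst (asm) sets_measure_of) auto
  show ?thesis
  proof (rule measure_eqI_generator_eq[where \<Omega>="UNIV \<times> space Y" and E="?E" and A="\<lambda>n. {..<real n} \<times> space Y"])
    show "Int_stable ?E"
    proof (rule Int_stableI)
      fix c d assume "c \<in> ?E" "d \<in> ?E"
      then obtain s t B C where cd: "c = {..<s} \<times> B" "d = {..<t} \<times> C" "B \<in> sets Y" "C \<in> sets Y"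
        by blast
      then have "c \<inter> d = {..<min s t} \<times> (B \<inter> C)" "B \<inter> C \<in> sets Y" by auto
      then show "c \<inter> d \<in> ?E" by blast
    qed
    show "?E \<subseteq> Pow (UNIV \<times> space Y)" using sets.sets_into_space[of _ Y] by auto
    show "(\<Union>n. {..<real n} \<times> space Y) = UNIV \<times> space Y"
      using reals_Archimedean2 by auto
    show "emeasure M ({..<real n} \<times> space Y) \<noteq> \<infinity>" for n
      using finite_measure.emeasure_finite[OF fin] by simp
  qed (use eq M N gen in auto)
qed

text \<open>
  The inverse transform method. The chosen conditional probabilities \<open>H r\<close> of the events \<open>X
  \<le> r\<close> are replaced by their exact values 0 and 1 outside \<open>[0, 1)\<close>. This is consistent
  because the mass sits on \<open>[0, 1]\<close>, and it makes the set in the definition of the quantile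
  nonempty and bounded below for every argument, so that the quantile kernel is a kernel without
  exceptions. Its value on the half-line below \<open>t\<close> is the supremum of \<open>h (y, z) r\<close> over rational
  \<open>r < t\<close>. Almost surely \<open>h\<close> is monotone in \<open>r\<close>, so the supremum is an increasing limit along a
  sequence and integrates to \<open>K z\<close> of the half-line, by monotone convergence on one side and
  continuity from below on the other.
\<close>
lemma conditional_kernel_unit_interval:
  fixes K :: "'c \<Rightarrow> (real \<times> 'b) measure"
  assumes K: "K \<in> Z \<rightarrow>\<^sub>M prob_algebra (borel \<Otimes>\<^sub>M Y)"
    and conc: "\<And>z. z \<in> space Z \<Longrightarrow> AE p in K z. 0 \<le> fst p \<and> fst p \<le> 1"
    and cp: "\<And>A. A \<in> sets borel \<Longrightarrow> \<exists>H. conditional_probability Y Z K A H"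
  shows "\<exists>Q. conditional_kernel borel Y Z K Q"
proof -
  have "\<forall>r::rat. \<exists>H. conditional_probability Y Z K {..of_rat r} H"
    using cp by simp
  then obtain H where H: "\<And>r::rat. conditional_probability Y Z K {..of_rat r} (H r)"
    by metis
  note L = marginal_snd_kernel[OF K]
  let ?L = "marginal_snd Y K"
  define h where "h p r = (if r < 0 then 0 else if 1 \<le> r then 1 else H r p)" for p and r :: rat
  have h_meas[measurable]: "(\<lambda>p. h p r) \<in> borel_measurable (Y \<Otimes>\<^sub>M Z)" for r
    using H[of r] unfolding h_def conditional_probability_def by auto
  have h01: "0 \<le> h p r" "h p r \<le> 1" for p r
    using H[of r] unfolding h_def conditional_probability_def by (cases p; auto)+
  have h_ends: "r < 0 \<Longrightarrow> h p r = 0" "1 \<le> r \<Longrightarrow> h p r = 1" for p r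
    by (auto simp: h_def)
  have spK: "space (K z) = UNIV \<times> space Y" if "z \<in> space Z" for z
    using kernelD(3)[OF K that] by (simp add: space_pair_measure)
  have h_int: "emeasure (K z) ({..of_rat r} \<times> B) = (\<integral>\<^sup>+y\<in>B. ennreal (h (y, z) r) \<partial>?L z)"
    if z: "z \<in> space Z" and B: "B \<in> sets Y" for z B r
  proof -
    have sK: "{..of_rat r} \<times> B \<in> sets (K z)" "UNIV \<times> B \<in> sets (K z)"
      using kernelD(2)[OF K z] B by auto
    consider "r < 0" | "1 \<le> r" | "0 \<le> r" "r < 1" by linarith
    then show ?thesis
    proof cases
      case 1
      then have r: "of_rat r < (0::real)" by simp
      have neg: "\<not> 0 \<le> a" if "a \<le> of_rat r" for a :: real
        using r that by linarith
      have "AE p in K z. p \<in> {..of_rat r} \<times> B \<longleftrightarrow> p \<in> {}"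
        using conc[OF z] by (rule AE_mp) (auto intro!: AE_I2 dest: neg)
      then have "emeasure (K z) ({..of_rat r} \<times> B) = emeasure (K z) {}"
        using sK by (intro emeasure_eq_AE) auto
      then show ?thesis using 1 by (simp add: h_def)
    next
      case 2
      then have r: "(1::real) \<le> of_rat r" by simp
      have "AE p in K z. p \<in> {..of_rat r} \<times> B \<longleftrightarrow> p \<in> UNIV \<times> B"
        using conc[OF z] by (rule AE_mp) (auto intro!: AE_I2 intro: order_trans[OF _ r])
      then have "emeasure (K z) ({..of_rat r} \<times> B) = emeasure (K z) (UNIV \<times> B)"
        using sK by (intro emeasure_eq_AE) auto
      also have "\<dots> = emeasure (?L z) B"
        using emeasure_marginal_snd[OF K z B] by simp
      finally show ?thesis using 2 B kernelD(2)[OF L z] by (simp add: h_def)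
    next
      case 3
      then show ?thesis using H[of r] z B by (simp add: h_def conditional_probability_def)
    qed
  qed
  have h_mono: "AE y in ?L z. \<forall>r s. r \<le> s \<longrightarrow> h (y, z) r \<le> h (y, z) s" if z: "z \<in> space Z" for z
  proof -
    have [measurable]: "(\<lambda>y. h (y, z) r) \<in> borel_measurable (?L z)" for r
      using z by (subst measurable_cong_sets[OF kernelD(2)[OF L z] refl]) measurable
    interpret Lz: prob_space "?L z" by (rule kernelD[OF L z])
    have "AE y in ?L z. ennreal (h (y, z) r) \<le> ennreal (h (y, z) s)" if "r \<le> s" for r s
    proof (rule AE_le_if_set_integrals_le)
      have "(\<integral>\<^sup>+y. ennreal (h (y, z) s) \<partial>?L z) \<le> (\<integral>\<^sup>+y. 1 \<partial>?L z)"
        using h01 by (intro nn_integral_mono) simp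
      then show "(\<integral>\<^sup>+y. ennreal (h (y, z) s) \<partial>?L z) \<noteq> \<infinity>"
        by (auto simp: Lz.emeasure_space_1 top_unique)
      fix B assume "B \<in> sets (?L z)"
      then have B: "B \<in> sets Y" using kernelD(2)[OF L z] by simp
      have "emeasure (K z) ({..of_rat r} \<times> B) \<le> emeasure (K z) ({..of_rat s} \<times> B)"
        using \<open>r \<le> s\<close> B kernelD(2)[OF K z]
        by (intro emeasure_mono) (auto simp: of_rat_less_eq intro: order_trans)
      then show "(\<integral>\<^sup>+y\<in>B. ennreal (h (y, z) r) \<partial>?L z) \<le> (\<integral>\<^sup>+y\<in>B. ennreal (h (y, z) s) \<partial>?L z)"
        by (simp add: h_int[OF z B])
    qed auto
    then show ?thesis
      using h01 by (simp add: AE_all_countable)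
  qed
  define Q where "Q p = distr uniform01 borel (rat_quantile (h p))" for p
  have q_less: "rat_quantile (h p) u < t \<longleftrightarrow> (\<exists>r. of_rat r < t \<and> u \<le> h p r)" if "0 < u" "u < 1" for p u t
    by (rule rat_quantile_less_iff) (use h_ends that in auto)
  have q_meas: "(\<lambda>(p, u). rat_quantile (h p) u) \<in> borel_measurable ((Y \<Otimes>\<^sub>M Z) \<Otimes>\<^sub>M uniform01)"
  proof (rule borel_measurableI_less)
    fix t :: real
    let ?W = "(Y \<Otimes>\<^sub>M Z) \<Otimes>\<^sub>M uniform01"
    have "(\<lambda>w. snd w) \<in> borel_measurable ?W"
      by (rule measurable_compose[OF measurable_snd]) (simp add: measurable_restrict_space1)
    moreover have "(\<lambda>w. h (fst w) r) \<in> borel_measurable ?W" for r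
      by measurable
    ultimately have "{w\<in>space ?W. \<exists>r. of_rat r < t \<and> snd w \<le> h (fst w) r} \<in> sets ?W"
      by measurable
    also have "{w\<in>space ?W. \<exists>r. of_rat r < t \<and> snd w \<le> h (fst w) r} =
        {w\<in>space ?W. (case w of (p, u) \<Rightarrow> rat_quantile (h p) u) < t}"
      by (auto simp: space_pair_measure space_restrict_space q_less)
    finally show "{w\<in>space ?W. (case w of (p, u) \<Rightarrow> rat_quantile (h p) u) < t} \<in> sets ?W" .
  qed
  have Q: "Q \<in> Y \<Otimes>\<^sub>M Z \<rightarrow>\<^sub>M prob_algebra borel"
    unfolding Q_def[abs_def]
    by (rule measurable_distr_prob_space2[OF _ q_meas])
       (auto simp: space_prob_algebra prob_space_uniform01)
  have Q_less: "emeasure (Q p) {..<t} = (SUP r\<in>{r. of_rat r < t}. ennreal (h p r))"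
    if p: "p \<in> space (Y \<Otimes>\<^sub>M Z)" for p t
  proof -
    have m: "rat_quantile (h p) \<in> borel_measurable uniform01"
      using measurable_Pair2[OF q_meas p] by simp
    have "emeasure (Q p) {..<t} = emeasure uniform01 {u\<in>{0<..<1}. \<exists>r\<in>{r. of_rat r < t}. u \<le> h p r}"
      unfolding Q_def using m
      by (subst emeasure_distr) (auto intro!: arg_cong[where f="emeasure uniform01"] simp: space_restrict_space q_less)
    also have "\<dots> = (SUP r\<in>{r. of_rat r < t}. ennreal (h p r))"
      using of_rat_dense[of "t - 1" t] h01 by (intro emeasure_uniform01_below_Sup) auto
    finally show ?thesis .
  qed
  have main: "emeasure (K z) ({..<t} \<times> B) = (\<integral>\<^sup>+y\<in>B. emeasure (Q (y, z)) {..<t} \<partial>?L z)"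
    if z: "z \<in> space Z" and B: "B \<in> sets Y" for z t B
  proof -
    have [measurable]: "(\<lambda>y. h (y, z) r) \<in> borel_measurable (?L z)" for r
      using z by (subst measurable_cong_sets[OF kernelD(2)[OF L z] refl]) measurable
    have [measurable]: "B \<in> sets (?L z)" using B kernelD(2)[OF L z] by simp
    obtain r :: "nat \<Rightarrow> rat" where r: "incseq r" "\<And>n. of_rat (r n) < t" "\<And>s. of_rat s < t \<Longrightarrow> \<exists>n. s \<le> r n"
      using ex_increasing_rats_below[of t] by blast
    have "emeasure (K z) ({..<t} \<times> B) = emeasure (K z) (\<Union>n. {..of_rat (r n)} \<times> B)"
    proof (rule arg_cong[where f="emeasure (K z)"], rule antisym)
      show "{..<t} \<times> B \<subseteq> (\<Union>n. {..of_rat (r n)} \<times> B)"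
      proof
        fix p assume p: "p \<in> {..<t} \<times> B"
        then obtain s :: rat where s: "fst p < of_rat s" "of_rat s < t"
          using of_rat_dense[of "fst p" t] by auto
        from r(3)[OF s(2)] obtain n where "s \<le> r n" ..
        then have "(of_rat s :: real) \<le> of_rat (r n)" by (simp add: of_rat_less_eq)
        with s p show "p \<in> (\<Union>n. {..of_rat (r n)} \<times> B)" by (auto intro!: exI[of _ n])
      qed
      show "(\<Union>n. {..of_rat (r n)} \<times> B) \<subseteq> {..<t} \<times> B"
        using r(2) by (auto intro: le_less_trans)
    qed
    also have "\<dots> = (SUP n. emeasure (K z) ({..of_rat (r n)} \<times> B))"
    proof (rule SUP_emeasure_incseq[symmetric])
      have "{..of_rat (r n)} \<times> B \<in> sets (K z)" for n
        unfolding kernelD(2)[OF K z] by (rule pair_measureI[OF _ B]) simp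
      then show "range (\<lambda>n. {..of_rat (r n)} \<times> B) \<subseteq> sets (K z)"
        by blast
      show "incseq (\<lambda>n. {..of_rat (r n) :: real} \<times> B)"
      proof (rule incseq_SucI)
        fix n
        have "(of_rat (r n) :: real) \<le> of_rat (r (Suc n))"
          using incseq_SucD[OF r(1)] by (simp add: of_rat_less_eq)
        then show "{..of_rat (r n)} \<times> B \<subseteq> {..of_rat (r (Suc n)) :: real} \<times> B" by auto
      qed
    qed
    also have "\<dots> = (SUP n. \<integral>\<^sup>+y\<in>B. ennreal (h (y, z) (r n)) \<partial>?L z)"
      by (simp add: h_int[OF z B])
    also have "\<dots> = (\<integral>\<^sup>+y. (SUP n. ennreal (h (y, z) (r n)) * indicator B y) \<partial>?L z)"
    proof (rule nn_integral_monotone_convergence_SUP_AE[symmetric])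
      show "AE y in ?L z. ennreal (h (y, z) (r n)) * indicator B y \<le> ennreal (h (y, z) (r (Suc n))) * indicator B y" for n
        using h_mono[OF z]
      proof (rule AE_mp, intro AE_I2 impI)
        fix y assume "\<forall>r s. r \<le> s \<longrightarrow> h (y, z) r \<le> h (y, z) s"
        then have "h (y, z) (r n) \<le> h (y, z) (r (Suc n))"
          using incseq_SucD[OF r(1), of n] by blast
        then show "ennreal (h (y, z) (r n)) * indicator B y \<le> ennreal (h (y, z) (r (Suc n))) * indicator B y"
          by (intro mult_right_mono ennreal_leI) auto
      qed
    qed measurable
    also have "\<dots> = (\<integral>\<^sup>+y\<in>B. emeasure (Q (y, z)) {..<t} \<partial>?L z)"
    proof (rule nn_integral_cong_AE)
      have *: "(SUP n. ennreal (h (y, z) (r n)) * indicator B y) = emeasure (Q (y, z)) {..<t} * indicator B y"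
        if y: "y \<in> space (?L z)" and mono: "\<forall>r s. r \<le> s \<longrightarrow> h (y, z) r \<le> h (y, z) s" for y
      proof (cases "y \<in> B")
        case True
        have "(SUP n. ennreal (h (y, z) (r n))) = (SUP r\<in>{r. of_rat r < t}. ennreal (h (y, z) r))"
        proof (rule antisym)
          show "(SUP n. ennreal (h (y, z) (r n))) \<le> (SUP r\<in>{r. of_rat r < t}. ennreal (h (y, z) r))"
            using r(2) by (intro SUP_least SUP_upper) auto
          show "(SUP r\<in>{r. of_rat r < t}. ennreal (h (y, z) r)) \<le> (SUP n. ennreal (h (y, z) (r n)))"
          proof (rule SUP_least)
            fix s assume "s \<in> {r. of_rat r < t}"
            then obtain n where "s \<le> r n" using r(3) by auto
            then have "ennreal (h (y, z) s) \<le> ennreal (h (y, z) (r n))"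
              using mono by (intro ennreal_leI) auto
            then show "ennreal (h (y, z) s) \<le> (SUP n. ennreal (h (y, z) (r n)))"
              by (rule SUP_upper2[rotated]) simp
          qed
        qed
        moreover have "(y, z) \<in> space (Y \<Otimes>\<^sub>M Z)"
          using y z kernelD(3)[OF L z] by (simp add: space_pair_measure)
        ultimately show ?thesis using True by (simp add: Q_less)
      qed simp
      show "AE y in ?L z. (SUP n. ennreal (h (y, z) (r n)) * indicator B y) = emeasure (Q (y, z)) {..<t} * indicator B y"
        using h_mono[OF z] by (rule AE_mp) (intro AE_I2 impI *)
    qed
    finally show ?thesis .
  qed
  have "conditional_kernel borel Y Z K Q"
    unfolding conditional_kernel_def
  proof (intro conjI Q ballI)
    fix z assume z: "z \<in> space Z"
    show "K z = kernel_product borel Y Q ?L z"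
    proof (rule real_product_measure_eqI)
      show "sets (K z) = sets (borel \<Otimes>\<^sub>M Y)" "sets (kernel_product borel Y Q ?L z) = sets (borel \<Otimes>\<^sub>M Y)"
        using kernelD(2)[OF K z] kernelD(2)[OF kernel_product_kernel[OF Q L] z] by auto
      show "finite_measure (K z)" by (rule prob_space.finite_measure[OF kernelD(1)[OF K z]])
      fix t B assume B: "B \<in> sets Y"
      show "emeasure (K z) ({..<t} \<times> B) = emeasure (kernel_product borel Y Q ?L z) ({..<t} \<times> B)"
        using main[OF z B, of t] emeasure_kernel_product_times[OF Q L z _ B, of "{..<t}"] by simp
    qed
  qed
  then show ?thesis by blast
qed

section \<open>Standard spaces\<close>

text \<open>
  Push \<open>K\<close> forward along \<open>f\<close>, disintegrate there, and push the result back along the left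
  inverse \<open>g\<close>: since \<open>g (f x) = x\<close>, the preimage of \<open>A\<close> under \<open>g\<close> has \<open>A\<close> as its preimage under
  \<open>f\<close>.
\<close>
lemma conditional_kernel_retract:
  assumes K: "K \<in> Z \<rightarrow>\<^sub>M prob_algebra (X \<Otimes>\<^sub>M Y)"
    and f: "f \<in> X \<rightarrow>\<^sub>M X'" and g: "g \<in> X' \<rightarrow>\<^sub>M X" and gf: "\<And>x. x \<in> space X \<Longrightarrow> g (f x) = x"
    and Q: "conditional_kernel X' Y Z (\<lambda>z. distr (K z) (X' \<Otimes>\<^sub>M Y) (\<lambda>p. (f (fst p), snd p))) Q"
  shows "conditional_kernel X Y Z K (\<lambda>p. distr (Q p) X g)"
proof -
  let ?F = "\<lambda>p. (f (fst p), snd p)"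
  let ?K = "\<lambda>z. distr (K z) (X' \<Otimes>\<^sub>M Y) ?F"
  note f[measurable] g[measurable]
  have F: "?F \<in> X \<Otimes>\<^sub>M Y \<rightarrow>\<^sub>M X' \<Otimes>\<^sub>M Y" by measurable
  have K': "?K \<in> Z \<rightarrow>\<^sub>M prob_algebra (X' \<Otimes>\<^sub>M Y)"
    by (rule measurable_compose[OF K measurable_distr_prob_space[OF F]])
  have FK: "?F \<in> K z \<rightarrow>\<^sub>M X' \<Otimes>\<^sub>M Y" if "z \<in> space Z" for z
    using F by (subst measurable_cong_sets[OF kernelD(2)[OF K that] refl])
  have marg: "marginal_snd Y ?K z = marginal_snd Y K z" if "z \<in> space Z" for z
    unfolding marginal_snd_def by (subst distr_distr[OF _ FK[OF that]]) (auto simp: comp_def)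
  have Qk: "Q \<in> Y \<Otimes>\<^sub>M Z \<rightarrow>\<^sub>M prob_algebra X'"
    and Qi: "\<And>z A B. z \<in> space Z \<Longrightarrow> A \<in> sets X' \<Longrightarrow> B \<in> sets Y \<Longrightarrow>
       emeasure (?K z) (A \<times> B) = (\<integral>\<^sup>+y\<in>B. emeasure (Q (y, z)) A \<partial>marginal_snd Y ?K z)"
    using Q unfolding conditional_kernel_iff[OF K'] by auto
  show ?thesis
    unfolding conditional_kernel_iff[OF K]
  proof (intro conjI ballI)
    show "(\<lambda>p. distr (Q p) X g) \<in> Y \<Otimes>\<^sub>M Z \<rightarrow>\<^sub>M prob_algebra X"
      by (rule measurable_compose[OF Qk measurable_distr_prob_space[OF g]])
    fix z A B assume z: "z \<in> space Z" and A: "A \<in> sets X" and B: "B \<in> sets Y"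
    let ?A = "g -` A \<inter> space X'"
    have A': "?A \<in> sets X'" using g A by simp
    have "?F -` (?A \<times> B) \<inter> space (K z) = A \<times> B"
      using sets.sets_into_space[OF A] sets.sets_into_space[OF B] kernelD(3)[OF K z] measurable_space[OF f] gf
      by (auto simp: space_pair_measure)
    then have "emeasure (K z) (A \<times> B) = emeasure (?K z) (?A \<times> B)"
      using FK[OF z] A' B by (subst emeasure_distr) auto
    also have "\<dots> = (\<integral>\<^sup>+y\<in>B. emeasure (Q (y, z)) ?A \<partial>marginal_snd Y K z)"
      by (simp only: Qi[OF z A' B] marg[OF z])
    also have "\<dots> = (\<integral>\<^sup>+y\<in>B. emeasure (distr (Q (y, z)) X g) A \<partial>marginal_snd Y K z)"
    proof (rule nn_integral_cong)
      fix y assume "y \<in> space (marginal_snd Y K z)"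
      then have "(y, z) \<in> space (Y \<Otimes>\<^sub>M Z)"
        using z by (simp add: space_pair_measure marginal_snd_def)
      from kernelD[OF Qk this] have "g \<in> Q (y, z) \<rightarrow>\<^sub>M X" "space (Q (y, z)) = space X'"
        using g by (auto cong: measurable_cong_sets)
      then show "emeasure (Q (y, z)) ?A * indicator B y = emeasure (distr (Q (y, z)) X g) A * indicator B y"
        using A by (simp add: emeasure_distr)
    qed
    finally show "emeasure (K z) (A \<times> B) = (\<integral>\<^sup>+y\<in>B. emeasure (distr (Q (y, z)) X g) A \<partial>marginal_snd Y K z)" .
  qed
qed

lemma conditional_kernel_standard:
  fixes X :: "'a measure" and K :: "'c \<Rightarrow> ('a \<times> 'b) measure"
  assumes K: "K \<in> Z \<rightarrow>\<^sub>M prob_algebra (X \<Otimes>\<^sub>M Y)" and X: "standard_space X"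
    and YZ: "countably_generated_space Y \<or> discrete_space Z"
  shows "\<exists>Q. conditional_kernel X Y Z K Q"
proof (cases "space X = {}")
  case True
  then show ?thesis using conditional_kernel_empty[OF K] by blast
next
  case False
  then obtain x0 where x0: "x0 \<in> space X" by auto
  from X obtain D f g where D: "D \<in> sets (borel :: real measure)" "D \<subseteq> {0..1}"
    and f: "f \<in> X \<rightarrow>\<^sub>M restrict_space borel D" and g: "g \<in> restrict_space borel D \<rightarrow>\<^sub>M X"
    and gf: "\<And>x. x \<in> space X \<Longrightarrow> g (f x) = x"
    unfolding standard_space_def by blast
  have fD: "f x \<in> D" if "x \<in> space X" for x
    using measurable_space[OF f that] by (simp add: space_restrict_space)
  then have f01: "0 \<le> f x" "f x \<le> 1" if "x \<in> space X" for x
    using that D(2) by fastforce+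
  have f'[measurable]: "f \<in> borel_measurable X"
    using f by (simp add: measurable_restrict_space2_iff)
  \<comment> \<open>The inverse of the isomorphism is defined on \<open>D\<close> only and is extended by a constant. The
  conditional kernel on the real line may charge the complement of \<open>D\<close>, but only for a null set of \<open>y\<close>.\<close>
  define g' where "g' r = (if r \<in> D then g r else x0)" for r
  have g': "g' \<in> borel \<rightarrow>\<^sub>M X"
    unfolding g'_def[abs_def] using measurable_restrict_space_iff[of D borel x0 X g] D x0 g by simp
  let ?F = "\<lambda>p. (f (fst p), snd p)"
  let ?K = "\<lambda>z. distr (K z) (borel \<Otimes>\<^sub>M Y) ?F"
  have F: "?F \<in> X \<Otimes>\<^sub>M Y \<rightarrow>\<^sub>M borel \<Otimes>\<^sub>M Y" by measurable
  have K': "?K \<in> Z \<rightarrow>\<^sub>M prob_algebra (borel \<Otimes>\<^sub>M Y)"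
    by (rule measurable_compose[OF K measurable_distr_prob_space[OF F]])
  have "\<exists>Q. conditional_kernel borel Y Z ?K Q"
  proof (rule conditional_kernel_unit_interval[OF K'])
    fix z assume z: "z \<in> space Z"
    have "?F \<in> K z \<rightarrow>\<^sub>M borel \<Otimes>\<^sub>M Y"
      using F by (subst measurable_cong_sets[OF kernelD(2)[OF K z] refl])
    then show "AE p in ?K z. 0 \<le> fst p \<and> fst p \<le> 1"
      using f01 kernelD(3)[OF K z]
      by (subst AE_distr_iff) (auto intro!: AE_I2 simp: space_pair_measure)
  next
    fix A :: "real set" assume "A \<in> sets borel"
    then show "\<exists>H. conditional_probability Y Z ?K A H"
      using YZ conditional_probability_countably_generated[OF K'] conditional_probability_discrete_parameter[OF K']
      by blast
  qed
  then obtain Q where "conditional_kernel borel Y Z ?K Q" ..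
  from conditional_kernel_retract[OF K f' g' _ this] gf fD show ?thesis
    by (auto simp: g'_def)
qed

section \<open>Explicit conditional kernels\<close>

lemma conditional_kernel_delta:
  assumes K: "K \<in> Z \<rightarrow>\<^sub>M prob_algebra (X \<Otimes>\<^sub>M Y)" and \<phi>: "\<phi> \<in> Y \<Otimes>\<^sub>M Z \<rightarrow>\<^sub>M X"
    and eq: "\<And>z. z \<in> space Z \<Longrightarrow> K z = kernel_product X Y (delta_kernel X \<phi>) (marginal_snd Y K) z"
  shows "conditional_kernel X Y Z K (delta_kernel X \<phi>)"
  unfolding conditional_kernel_def delta_kernel_def[abs_def]
  using measurable_compose[OF \<phi> measurable_return_prob_space] eq
  by (simp add: delta_kernel_def[abs_def])

text \<open>
  Every event that depends on \<open>Y\<close> alone has probability 0 or 1 under \<open>K z\<close>. Hence \<open>X\<close> and \<open>Y\<close>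
  are independent, and the first marginal of \<open>K z\<close> is a conditional law for every \<open>y\<close>.
\<close>
lemma conditional_kernel_deterministic_marginal:
  assumes K: "K \<in> Z \<rightarrow>\<^sub>M prob_algebra (X \<Otimes>\<^sub>M Y)" and \<phi>: "\<phi> \<in> Z \<rightarrow>\<^sub>M Y"
    and eq: "\<And>z. z \<in> space Z \<Longrightarrow> marginal_snd Y K z = delta_kernel Y \<phi> z"
  shows "conditional_kernel X Y Z K (\<lambda>(y, z). distr (K z) X fst)"
  unfolding conditional_kernel_iff[OF K]
proof (intro conjI ballI)
  show "(\<lambda>(y, z). distr (K z) X fst) \<in> Y \<Otimes>\<^sub>M Z \<rightarrow>\<^sub>M prob_algebra X"
    unfolding case_prod_beta'
    by (rule measurable_compose[OF measurable_snd measurable_compose[OF K measurable_distr_prob_space]]) simp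
  fix z A B assume z: "z \<in> space Z" and A: "A \<in> sets X" and B: "B \<in> sets Y"
  interpret Kz: prob_space "K z" by (rule kernelD[OF K z])
  have s: "A \<times> B \<in> sets (K z)" "A \<times> space Y \<in> sets (K z)" "space X \<times> B \<in> sets (K z)"
    using A B kernelD(2)[OF K z] by auto
  have sp: "space (K z) = space X \<times> space Y"
    using kernelD(3)[OF K z] by (simp add: space_pair_measure)
  have "emeasure (K z) (space X \<times> B) = indicator B (\<phi> z)"
    using emeasure_marginal_snd[OF K z B] B by (simp add: eq[OF z] delta_kernel_def)
  then have "Kz.prob (space X \<times> B) = indicator B (\<phi> z)"
    by (auto simp: measure_def indicator_def)
  then have ae: "AE p in K z. p \<in> space X \<times> B \<longleftrightarrow> \<phi> z \<in> B"
    using Kz.prob_eq_0[OF s(3)] Kz.prob_eq_1[OF s(3)] by (cases "\<phi> z \<in> B") auto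
  have "emeasure (K z) (A \<times> B) = emeasure (K z) (if \<phi> z \<in> B then A \<times> space Y else {})"
  proof (rule emeasure_eq_AE)
    show "AE p in K z. p \<in> A \<times> B \<longleftrightarrow> p \<in> (if \<phi> z \<in> B then A \<times> space Y else {})"
      using ae
    proof (rule AE_mp, intro AE_I2 impI)
      fix p assume "p \<in> space (K z)" "p \<in> space X \<times> B \<longleftrightarrow> \<phi> z \<in> B"
      then show "p \<in> A \<times> B \<longleftrightarrow> p \<in> (if \<phi> z \<in> B then A \<times> space Y else {})"
        using sets.sets_into_space[OF B] by (auto simp: sp split: if_splits)
    qed
  qed (use s in auto)
  also have "\<dots> = emeasure (distr (K z) X fst) A * indicator B (\<phi> z)"
  proof -
    have "fst \<in> K z \<rightarrow>\<^sub>M X" by (subst measurable_cong_sets[OF kernelD(2)[OF K z] refl]) simp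
    moreover have "fst -` A \<inter> space (K z) = A \<times> space Y"
      using sets.sets_into_space[OF A] by (auto simp: sp)
    ultimately show ?thesis using A by (simp add: emeasure_distr)
  qed
  also have "\<dots> = (\<integral>\<^sup>+y\<in>B. emeasure (distr (K z) X fst) A \<partial>marginal_snd Y K z)"
    using measurable_space[OF \<phi> z] B
    by (simp add: eq[OF z] delta_kernel_def nn_integral_return)
  finally show "emeasure (K z) (A \<times> B) =
      (\<integral>\<^sup>+y\<in>B. emeasure (case (y, z) of (y, z) \<Rightarrow> distr (K z) X fst) A \<partial>marginal_snd Y K z)" by simp
qed

text \<open>
  The elementary conditional probability \<open>K z (A \<times> {y}) / K z (X \<times> {y})\<close>, with a
  fixed point mass where the denominator vanishes. Joint measurability reduces to measurability
  in \<open>z\<close>, and measures on \<open>Y\<close> are compared on singletons, because \<open>Y\<close> is countable with all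
  subsets measurable.
\<close>
lemma conditional_kernel_discrete:
  fixes X :: "'a measure" and Y :: "'b measure" and Z :: "'c measure"
  assumes K: "K \<in> Z \<rightarrow>\<^sub>M prob_algebra (X \<Otimes>\<^sub>M Y)" and Y: "discrete_space Y"
  shows "\<exists>Q. conditional_kernel X Y Z K Q"
proof (cases "space X = {}")
  case True
  then show ?thesis using conditional_kernel_empty[OF K] by blast
next
  case False
  then obtain x0 where x0: "x0 \<in> space X" by auto
  have Yc: "countable (space Y)" "sets Y = Pow (space Y)"
    using Y by (auto simp: discrete_space_def)
  note L = marginal_snd_kernel[OF K]
  define C where "C y = space X \<times> {y}" for y :: 'b
  define Q where "Q = (\<lambda>(y, z). if emeasure (K z) (C y) = 0 then return X x0
    else distr (uniform_measure (K z) (C y)) X fst)"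
  have Q_emeasure: "emeasure (Q (y, z)) A = (if emeasure (K z) (C y) = 0 then indicator A x0
      else emeasure (K z) (A \<times> {y}) / emeasure (K z) (C y))"
    and Q_prob: "prob_space (Q (y, z))" and Q_sets: "sets (Q (y, z)) = sets X"
    if z: "z \<in> space Z" and y: "y \<in> space Y" and A: "A \<in> sets X" for z y A
  proof -
    interpret Kz: prob_space "K z" by (rule kernelD[OF K z])
    have s[simp]: "C y \<in> sets (K z)" "A \<times> {y} \<in> sets (K z)" "A \<times> space Y \<in> sets (K z)"
      using kernelD(2)[OF K z] y Yc(2) A by (auto simp: C_def)
    have sp: "space (K z) = space X \<times> space Y"
      using kernelD(3)[OF K z] by (simp add: space_pair_measure)
    have m: "fst \<in> K z \<rightarrow>\<^sub>M X" by (subst measurable_cong_sets[OF kernelD(2)[OF K z] refl]) simp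
    show "sets (Q (y, z)) = sets X" by (simp add: Q_def)
    have fin: "emeasure (K z) (C y) \<noteq> \<infinity>" by simp
    show "prob_space (Q (y, z))"
    proof (cases "emeasure (K z) (C y) = 0")
      case True then show ?thesis using x0 by (simp add: Q_def prob_space_return)
    next
      case False
      then have "prob_space (uniform_measure (K z) (C y))"
        using fin by (intro prob_space_uniform_measure) auto
      then show ?thesis
        using False m by (simp add: Q_def) (intro prob_space.prob_space_distr; simp)
    qed
    have "emeasure (distr (uniform_measure (K z) (C y)) X fst) A = emeasure (uniform_measure (K z) (C y)) (A \<times> space Y)"
    proof -
      have "fst -` A \<inter> space (K z) = A \<times> space Y"
        using sets.sets_into_space[OF A] by (auto simp: sp)
      then show ?thesis using m A by (simp add: emeasure_distr)
    qed
    also have "\<dots> = emeasure (K z) (C y \<inter> (A \<times> space Y)) / emeasure (K z) (C y)"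
      by (rule emeasure_uniform_measure) (rule s)+
    also have "C y \<inter> (A \<times> space Y) = A \<times> {y}"
      using sets.sets_into_space[OF A] y by (auto simp: C_def)
    finally show "emeasure (Q (y, z)) A = (if emeasure (K z) (C y) = 0 then indicator A x0
      else emeasure (K z) (A \<times> {y}) / emeasure (K z) (C y))"
      using A by (simp add: Q_def)
  qed
  have Q: "Q \<in> Y \<Otimes>\<^sub>M Z \<rightarrow>\<^sub>M prob_algebra X"
    unfolding markov_kernel_iff
  proof (intro conjI ballI)
    fix p assume "p \<in> space (Y \<Otimes>\<^sub>M Z)"
    then show "prob_space (Q p)" "sets (Q p) = sets X"
      using Q_prob[OF _ _ sets.top] Q_sets[OF _ _ sets.top] by (auto simp: space_pair_measure)
  next
    fix A assume A: "A \<in> sets X"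
    have m: "(\<lambda>z. emeasure (K z) (A \<times> {y})) \<in> borel_measurable Z" if "y \<in> space Y" "A \<in> sets X" for y A
      using K that Yc(2) by (auto simp: markov_kernel_iff)
    have "(\<lambda>z. emeasure (Q (y, z)) A) \<in> borel_measurable Z" if y: "y \<in> space Y" for y
    proof -
      note [measurable] = m[OF y A] m[OF y sets.top, folded C_def]
      show ?thesis
        by (subst measurable_cong[OF Q_emeasure[OF _ y A]]) measurable
    qed
    then have "(\<lambda>p. emeasure (Q p) A) \<in> borel_measurable (count_space (space Y) \<Otimes>\<^sub>M Z)"
      by (intro measurable_pair_measure_countable1 Yc(1))
    moreover have "sets (count_space (space Y) \<Otimes>\<^sub>M Z) = sets (Y \<Otimes>\<^sub>M Z)"
      by (rule sets_pair_measure_cong[OF _ refl]) (simp add: Yc(2))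
    ultimately show "(\<lambda>p. emeasure (Q p) A) \<in> borel_measurable (Y \<Otimes>\<^sub>M Z)"
      using measurable_cong_sets by blast
  qed
  have "conditional_kernel X Y Z K Q"
    unfolding conditional_kernel_iff[OF K]
  proof (intro conjI Q ballI)
    fix z A B assume z: "z \<in> space Z" and A: "A \<in> sets X" and B: "B \<in> sets Y"
    interpret Kz: prob_space "K z" by (rule kernelD[OF K z])
    have Ls: "sets (marginal_snd Y K z) = Pow (space Y)" "space (marginal_snd Y K z) = space Y"
      using kernelD[OF L z] Yc by auto
    let ?D = "density (marginal_snd Y K z) (\<lambda>y. emeasure (Q (y, z)) A)"
    have meas: "f \<in> borel_measurable (marginal_snd Y K z)" for f :: "_ \<Rightarrow> ennreal"
      by (auto simp: measurable_def Ls)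
    have "slice_measure Y (K z) A = ?D"
    proof (rule measure_eqI_countable[OF _ _ Yc(1)])
      fix y assume y: "y \<in> space Y"
      have "emeasure ?D {y} = emeasure (Q (y, z)) A * emeasure (marginal_snd Y K z) {y}"
        using y Ls meas by (subst emeasure_density) (auto simp: nn_integral_indicator_singleton)
      also have "\<dots> = emeasure (Q (y, z)) A * emeasure (K z) (C y)"
        using y Yc by (subst emeasure_marginal_snd[OF K z]) (auto simp: C_def)
      also have "\<dots> = emeasure (K z) (A \<times> {y})"
      proof (cases "emeasure (K z) (C y) = 0")
        case True
        have "emeasure (K z) (A \<times> {y}) \<le> emeasure (K z) (C y)"
          using sets.sets_into_space[OF A] kernelD(2)[OF K z] y Yc(2)
          by (intro emeasure_mono) (auto simp: C_def)
        with True show ?thesis by simp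
      next
        case False
        then have "emeasure (K z) (A \<times> {y}) / emeasure (K z) (C y) * emeasure (K z) (C y) = emeasure (K z) (A \<times> {y})"
          using Kz.emeasure_finite[of "C y"]
          by (simp add: ennreal_divide_times ennreal_divide_self ennreal_mult_divide_eq ennreal_times_divide)
        then show ?thesis using False by (simp add: Q_emeasure[OF z y A])
      qed
      finally show "emeasure (slice_measure Y (K z) A) {y} = emeasure ?D {y}"
        using emeasure_slice_measure[OF kernelD(2)[OF K z] A, of "{y}"] y Yc(2) by simp
    qed (use Ls Yc in simp_all)
    then have "emeasure (slice_measure Y (K z) A) B = emeasure ?D B" by simp
    then show "emeasure (K z) (A \<times> B) = (\<integral>\<^sup>+y\<in>B. emeasure (Q (y, z)) A \<partial>marginal_snd Y K z)"
      using emeasure_slice_measure[OF kernelD(2)[OF K z] A B] B Yc meas Ls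
      by (simp add: emeasure_density)
  qed
  then show ?thesis by blast
qed

text \<open>
  By Tonelli the marginal has density \<open>marginal_density\<close> with respect to \<open>\<nu>\<close>. Its integral
  is 1, so it is almost everywhere finite; where it is 0, so is the integral of \<open>k\<close> over \<open>A\<close>.
  Hence marginal density times quotient kernel recovers the integral of \<open>k\<close> over \<open>A\<close> for
  \<open>\<nu>\<close>-almost every \<open>y\<close>, including those where the kernel takes its default value \<open>P\<close>.
\<close>
lemma conditional_kernel_density:
  fixes X :: "'a measure" and Y :: "'b measure" and Z :: "'c measure"
  assumes K: "K \<in> Z \<rightarrow>\<^sub>M prob_algebra (X \<Otimes>\<^sub>M Y)"
    and k: "has_joint_density X Y Z K \<mu> \<nu> k" and P: "prob_space P" "sets P = sets X"
  shows "conditional_kernel X Y Z K (density_quotient_kernel \<mu> k P)"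
proof -
  let ?Q = "density_quotient_kernel \<mu> k P" and ?m = "marginal_density \<mu> k"
  interpret \<mu>: sigma_finite_measure \<mu> using k by (simp add: has_joint_density_def)
  interpret \<nu>: sigma_finite_measure \<nu> using k by (simp add: has_joint_density_def)
  interpret \<mu>\<nu>: pair_sigma_finite \<mu> \<nu> ..
  have s[measurable_cong]: "sets \<mu> = sets X" "sets \<nu> = sets Y"
    using k by (auto simp: has_joint_density_def)
  have sp: "space \<mu> = space X" "space \<nu> = space Y"
    using s[THEN sets_eq_imp_space_eq] by auto
  have "(\<lambda>(x, y, z). k x y z) \<in> borel_measurable (X \<Otimes>\<^sub>M Y \<Otimes>\<^sub>M Z)"
    using k by (simp add: has_joint_density_def)
  from measurable_compose[OF this measurable_ennreal]
  have kk: "(\<lambda>(x, y, z). ennreal (k x y z)) \<in> borel_measurable (X \<Otimes>\<^sub>M Y \<Otimes>\<^sub>M Z)"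
    by (simp add: case_prod_beta')
  have kx: "(\<lambda>(p, x). ennreal (k x (fst p) (snd p))) \<in> borel_measurable ((Y \<Otimes>\<^sub>M Z) \<Otimes>\<^sub>M X)"
  proof -
    have "(\<lambda>w. (snd w, fst (fst w), snd (fst w))) \<in> (Y \<Otimes>\<^sub>M Z) \<Otimes>\<^sub>M X \<rightarrow>\<^sub>M X \<Otimes>\<^sub>M Y \<Otimes>\<^sub>M Z"
      by measurable
    from measurable_compose[OF this kk]
    show ?thesis by (simp add: case_prod_beta')
  qed
  have sect: "(\<lambda>x. ennreal (k x y z)) \<in> borel_measurable X" if "y \<in> space Y" "z \<in> space Z" for y z
    using measurable_Pair2[OF kx, of "(y, z)"] that by (simp add: space_pair_measure)
  have m_meas: "(\<lambda>p. ?m (fst p) (snd p)) \<in> borel_measurable (Y \<Otimes>\<^sub>M Z)"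
  proof -
    have "(\<lambda>(p, x). ennreal (k x (fst p) (snd p))) \<in> borel_measurable ((Y \<Otimes>\<^sub>M Z) \<Otimes>\<^sub>M \<mu>)"
      using kx by (subst measurable_cong_sets[OF sets_pair_measure_cong[OF refl s(1)] refl])
    from \<mu>.borel_measurable_nn_integral[OF this] show ?thesis
      by (simp add: marginal_density_def)
  qed
  have A_meas: "(\<lambda>p. \<integral>\<^sup>+x\<in>A. ennreal (k x (fst p) (snd p)) \<partial>\<mu>) \<in> borel_measurable (Y \<Otimes>\<^sub>M Z)"
    if A: "A \<in> sets X" for A
  proof -
    have "(\<lambda>(p, x). ennreal (k x (fst p) (snd p)) * indicator A x) \<in> borel_measurable ((Y \<Otimes>\<^sub>M Z) \<Otimes>\<^sub>M X)"
      using kx A by (simp add: case_prod_beta')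
    then have "(\<lambda>(p, x). ennreal (k x (fst p) (snd p)) * indicator A x) \<in> borel_measurable ((Y \<Otimes>\<^sub>M Z) \<Otimes>\<^sub>M \<mu>)"
      by (subst measurable_cong_sets[OF sets_pair_measure_cong[OF refl s(1)] refl])
    from \<mu>.borel_measurable_nn_integral[OF this] show ?thesis by simp
  qed
  have Q_emeasure: "emeasure (?Q (y, z)) A = (if 0 < ?m y z \<and> ?m y z < \<infinity>
      then (\<integral>\<^sup>+x\<in>A. ennreal (k x y z) \<partial>\<mu>) / ?m y z else emeasure P A)"
    if y: "y \<in> space Y" and z: "z \<in> space Z" and A: "A \<in> sets X" for y z A
  proof -
    have k': "(\<lambda>x. ennreal (k x y z)) \<in> borel_measurable \<mu>"
      using sect[OF y z] by (simp cong: measurable_cong_sets add: s)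
    have "emeasure (density \<mu> (\<lambda>x. ennreal (k x y z) / ?m y z)) A =
        (\<integral>\<^sup>+x. (ennreal (k x y z) * indicator A x) / ?m y z \<partial>\<mu>)"
      using k' A s by (subst emeasure_density) (auto simp: divide_ennreal_def ac_simps)
    also have "\<dots> = (\<integral>\<^sup>+x\<in>A. ennreal (k x y z) \<partial>\<mu>) / ?m y z"
      using k' A s by (intro nn_integral_divide) auto
    finally show ?thesis by (simp add: density_quotient_kernel_def)
  qed
  have Q: "?Q \<in> Y \<Otimes>\<^sub>M Z \<rightarrow>\<^sub>M prob_algebra X"
    unfolding markov_kernel_iff
  proof (intro conjI ballI)
    fix p assume "p \<in> space (Y \<Otimes>\<^sub>M Z)"
    then obtain y z where p: "p = (y, z)" "y \<in> space Y" "z \<in> space Z" by (auto simp: space_pair_measure)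
    show sQ: "sets (?Q p) = sets X" by (simp add: p density_quotient_kernel_def s P)
    then have "space (?Q p) = space X" by (rule sets_eq_imp_space_eq)
    moreover have "emeasure (?Q p) (space X) = 1"
    proof (cases "0 < ?m y z \<and> ?m y z < \<infinity>")
      case True
      have "(\<integral>\<^sup>+x\<in>space X. ennreal (k x y z) \<partial>\<mu>) = ?m y z"
        unfolding marginal_density_def by (intro nn_integral_cong) (simp add: sp)
      with True show ?thesis
        by (simp add: p Q_emeasure ennreal_divide_self zero_less_iff_neq_zero less_top)
    next
      case False
      then show ?thesis
        using prob_space.emeasure_space_1[OF P(1)] sets_eq_imp_space_eq[OF P(2)] p
        by (simp only: p Q_emeasure sets.top if_not_P if_False)
    qed
    ultimately show "prob_space (?Q p)" by (intro prob_spaceI) simp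
  next
    fix A assume A: "A \<in> sets X"
    have quotient: "(\<lambda>p. if 0 < u p \<and> u p < \<infinity> then v p / u p else emeasure P A) \<in> borel_measurable N"
      if [measurable]: "u \<in> borel_measurable N" "v \<in> borel_measurable N" for u v ::  "'b \<times> 'c \<Rightarrow> ennreal" and N
      by measurable
    have "emeasure (?Q p) A = (if 0 < ?m (fst p) (snd p) \<and> ?m (fst p) (snd p) < \<infinity>
      then (\<integral>\<^sup>+x\<in>A. ennreal (k x (fst p) (snd p)) \<partial>\<mu>) / ?m (fst p) (snd p) else emeasure P A)"
      if "p \<in> space (Y \<Otimes>\<^sub>M Z)" for p
      using that Q_emeasure[OF _ _ A, of "fst p" "snd p"] by (auto simp: space_pair_measure)
    then show "(\<lambda>p. emeasure (?Q p) A) \<in> borel_measurable (Y \<Otimes>\<^sub>M Z)"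
      using quotient[OF m_meas A_meas[OF A]] by (subst measurable_cong)
  qed
  show ?thesis
    unfolding conditional_kernel_iff[OF K]
  proof (intro conjI Q ballI)
    fix z A B assume z: "z \<in> space Z" and A: "A \<in> sets X" and B: "B \<in> sets Y"
    let ?L = "marginal_snd Y K z"
    have Kz: "K z = density (\<mu> \<Otimes>\<^sub>M \<nu>) (\<lambda>(x, y). ennreal (k x y z))"
      using k z by (simp add: has_joint_density_def)
    have kz: "(\<lambda>(x, y). ennreal (k x y z)) \<in> borel_measurable (\<mu> \<Otimes>\<^sub>M \<nu>)"
    proof -
      have "(\<lambda>w. (fst w, snd w, z)) \<in> X \<Otimes>\<^sub>M Y \<rightarrow>\<^sub>M X \<Otimes>\<^sub>M Y \<Otimes>\<^sub>M Z"
        using z by measurable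
      from measurable_compose[OF this kk]
      have "(\<lambda>(x, y). ennreal (k x y z)) \<in> borel_measurable (X \<Otimes>\<^sub>M Y)" by (simp add: case_prod_beta')
      then show ?thesis by (subst measurable_cong_sets[OF sets_pair_measure_cong[OF s] refl])
    qed
    have rect: "emeasure (K z) (A \<times> B) = (\<integral>\<^sup>+y\<in>B. (\<integral>\<^sup>+x\<in>A. ennreal (k x y z) \<partial>\<mu>) \<partial>\<nu>)"
      if A: "A \<in> sets X" and B: "B \<in> sets Y" for A B
    proof -
      have AB: "A \<times> B \<in> sets (\<mu> \<Otimes>\<^sub>M \<nu>)" using A B s by auto
      have "emeasure (K z) (A \<times> B) = (\<integral>\<^sup>+w. (case w of (x, y) \<Rightarrow> ennreal (k x y z)) * indicator (A \<times> B) w \<partial>(\<mu> \<Otimes>\<^sub>M \<nu>))"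
        unfolding Kz by (rule emeasure_density[OF kz AB])
      also have "\<dots> = (\<integral>\<^sup>+y. \<integral>\<^sup>+x. ennreal (k x y z) * indicator (A \<times> B) (x, y) \<partial>\<mu> \<partial>\<nu>)"
        using kz AB by (subst \<mu>\<nu>.nn_integral_snd[symmetric]) (auto simp: case_prod_beta')
      also have "\<dots> = (\<integral>\<^sup>+y\<in>B. (\<integral>\<^sup>+x\<in>A. ennreal (k x y z) \<partial>\<mu>) \<partial>\<nu>)"
        by (intro nn_integral_cong) (auto simp: indicator_def)
      finally show ?thesis .
    qed
    have mz: "(\<lambda>y. ?m y z) \<in> borel_measurable \<nu>"
      using measurable_Pair1[OF m_meas, of z] z by (simp cong: measurable_cong_sets add: s) 
    have L: "?L = density \<nu> (\<lambda>y. ?m y z)"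
    proof (rule measure_eqI)
      show "sets ?L = sets (density \<nu> (\<lambda>y. ?m y z))" by (simp add: marginal_snd_def s)
      fix B assume "B \<in> sets ?L"
      then have B: "B \<in> sets Y" by (simp add: marginal_snd_def)
      have "emeasure ?L B = (\<integral>\<^sup>+y\<in>B. (\<integral>\<^sup>+x\<in>space X. ennreal (k x y z) \<partial>\<mu>) \<partial>\<nu>)"
        using emeasure_marginal_snd[OF K z B] rect[OF sets.top B] by simp
      also have "\<dots> = (\<integral>\<^sup>+y\<in>B. ?m y z \<partial>\<nu>)"
        unfolding marginal_density_def by (intro nn_integral_cong arg_cong2[where f="(*)"]) (auto simp: sp intro!: nn_integral_cong)
      also have "\<dots> = emeasure (density \<nu> (\<lambda>y. ?m y z)) B"
        using mz B s by (simp add: emeasure_density)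
      finally show "emeasure ?L B = emeasure (density \<nu> (\<lambda>y. ?m y z)) B" .
    qed
    have "AE y in \<nu>. ?m y z \<noteq> \<infinity>"
    proof (rule nn_integral_PInf_AE[OF mz])
      have "(\<integral>\<^sup>+y. ?m y z \<partial>\<nu>) = emeasure ?L (space Y)"
        unfolding L using mz s by (subst emeasure_density) (auto intro!: nn_integral_cong simp: sp)
      also have "\<dots> = 1"
        using prob_space.emeasure_space_1[OF kernelD(1)[OF marginal_snd_kernel[OF K] z]]
          kernelD(3)[OF marginal_snd_kernel[OF K] z] by simp
      finally show "(\<integral>\<^sup>+y. ?m y z \<partial>\<nu>) \<noteq> \<infinity>" by simp
    qed
    then have ae: "AE y in \<nu>. ?m y z * emeasure (?Q (y, z)) A = (\<integral>\<^sup>+x\<in>A. ennreal (k x y z) \<partial>\<mu>)"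
    proof (rule AE_mp, intro AE_I2 impI)
      fix y assume y: "y \<in> space \<nu>" and fin: "?m y z \<noteq> \<infinity>"
      have le: "(\<integral>\<^sup>+x\<in>A. ennreal (k x y z) \<partial>\<mu>) \<le> ?m y z"
        unfolding marginal_density_def by (intro nn_integral_mono) (auto simp: indicator_def)
      show "?m y z * emeasure (?Q (y, z)) A = (\<integral>\<^sup>+x\<in>A. ennreal (k x y z) \<partial>\<mu>)"
      proof (cases "?m y z = 0")
        case True then show ?thesis using le by simp
      next
        case False
        then show ?thesis
          using fin y z A sp by (simp add: Q_emeasure less_top zero_less_iff_neq_zero ennreal_times_divide ennreal_mult_divide_eq mult.commute[of "?m y z"])
      qed
    qed
    have QA: "(\<lambda>y. emeasure (?Q (y, z)) A) \<in> borel_measurable \<nu>"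
    proof -
      have "(\<lambda>p. emeasure (?Q p) A) \<in> borel_measurable (Y \<Otimes>\<^sub>M Z)"
        using Q A by (simp add: markov_kernel_iff)
      from measurable_Pair1[OF this z] show ?thesis by (simp cong: measurable_cong_sets add: s)
    qed
    have "emeasure (K z) (A \<times> B) = (\<integral>\<^sup>+y. ?m y z * (emeasure (?Q (y, z)) A * indicator B y) \<partial>\<nu>)"
      unfolding rect[OF A B]
      by (rule nn_integral_cong_AE, rule AE_mp[OF ae], intro AE_I2) (simp flip: mult.assoc)
    also have "\<dots> = (\<integral>\<^sup>+y\<in>B. emeasure (?Q (y, z)) A \<partial>?L)"
      unfolding L using mz QA B s by (subst nn_integral_density) auto
    finally show "emeasure (K z) (A \<times> B) = (\<integral>\<^sup>+y\<in>B. emeasure (?Q (y, z)) A \<partial>?L)" .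
  qed
qed

lemma ex_conditional_kernel_density:
  assumes K: "K \<in> Z \<rightarrow>\<^sub>M prob_algebra (X \<Otimes>\<^sub>M Y)" and k: "has_joint_density X Y Z K \<mu> \<nu> k"
  shows "\<exists>Q. conditional_kernel X Y Z K Q"
proof (cases "space X = {}")
  case True
  then show ?thesis using conditional_kernel_empty[OF K] by blast
next
  case False
  then obtain x0 where "x0 \<in> space X" by auto
  then show ?thesis
    using conditional_kernel_density[OF K k prob_space_return sets_return] by blast
qed

theorem theorem2p28:
  fixes X :: "'a measure" and Y :: "'b measure" and Z :: "'c measure"
  shows
    "(\<forall>K \<in> Z \<rightarrow>\<^sub>M prob_algebra (X \<Otimes>\<^sub>M Y).
        (standard_space X \<and> countably_generated_space Y) \<or>
        (standard_space X \<and> discrete_space Z) \<or>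
        discrete_space Y \<or>
        (\<exists>\<mu> \<nu> k. has_joint_density X Y Z K \<mu> \<nu> k) \<or>
        (\<exists>\<phi> \<in> Y \<Otimes>\<^sub>M Z \<rightarrow>\<^sub>M X. \<forall>z\<in>space Z.
           K z = kernel_product X Y (delta_kernel X \<phi>) (marginal_snd Y K) z) \<or>
        (\<exists>\<phi> \<in> Z \<rightarrow>\<^sub>M Y. \<forall>z\<in>space Z. marginal_snd Y K z = delta_kernel Y \<phi> z)
        \<longrightarrow> (\<exists>Q. conditional_kernel X Y Z K Q)) \<and>
     (\<forall>K \<in> Z \<rightarrow>\<^sub>M prob_algebra (X \<Otimes>\<^sub>M Y). \<forall>\<mu> \<nu> k P.
        has_joint_density X Y Z K \<mu> \<nu> k \<and> prob_space P \<and> sets P = sets X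
        \<longrightarrow> conditional_kernel X Y Z K (density_quotient_kernel \<mu> k P)) \<and>
     ((standard_space X \<and> countably_generated_space Y) \<or>
      (standard_space X \<and> discrete_space Z) \<or>
      discrete_space Y
      \<longrightarrow> disintegration_triple X Y Z)"
proof (intro conjI ballI allI impI)
  fix K assume K: "K \<in> Z \<rightarrow>\<^sub>M prob_algebra (X \<Otimes>\<^sub>M Y)"
  show "\<exists>Q. conditional_kernel X Y Z K Q"
    if "(standard_space X \<and> countably_generated_space Y) \<or>
        (standard_space X \<and> discrete_space Z) \<or>
        discrete_space Y \<or>
        (\<exists>\<mu> \<nu> k. has_joint_density X Y Z K \<mu> \<nu> k) \<or>
        (\<exists>\<phi> \<in> Y \<Otimes>\<^sub>M Z \<rightarrow>\<^sub>M X. \<forall>z\<in>space Z.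
           K z = kernel_product X Y (delta_kernel X \<phi>) (marginal_snd Y K) z) \<or>
        (\<exists>\<phi> \<in> Z \<rightarrow>\<^sub>M Y. \<forall>z\<in>space Z. marginal_snd Y K z = delta_kernel Y \<phi> z)"
    using that
  proof (elim disjE conjE exE bexE)
    show ?thesis if "standard_space X" "countably_generated_space Y"
      using conditional_kernel_standard[OF K] that by blast
    show ?thesis if "standard_space X" "discrete_space Z"
      using conditional_kernel_standard[OF K] that by blast
    show ?thesis if "discrete_space Y"
      by (rule conditional_kernel_discrete[OF K that])
    show ?thesis if "has_joint_density X Y Z K \<mu> \<nu> k" for \<mu> \<nu> k
      by (rule ex_conditional_kernel_density[OF K that])
    show ?thesis if "\<phi> \<in> Y \<Otimes>\<^sub>M Z \<rightarrow>\<^sub>M X"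
      "\<forall>z\<in>space Z. K z = kernel_product X Y (delta_kernel X \<phi>) (marginal_snd Y K) z" for \<phi>
      using conditional_kernel_delta[OF K that(1)] that(2) by blast
    show ?thesis if "\<phi> \<in> Z \<rightarrow>\<^sub>M Y" "\<forall>z\<in>space Z. marginal_snd Y K z = delta_kernel Y \<phi> z" for \<phi>
      using conditional_kernel_deterministic_marginal[OF K that(1)] that(2) by blast
  qed
next
  fix K \<mu> \<nu> k P
  assume "K \<in> Z \<rightarrow>\<^sub>M prob_algebra (X \<Otimes>\<^sub>M Y)"
    and "has_joint_density X Y Z K \<mu> \<nu> k \<and> prob_space P \<and> sets P = sets X"
  then show "conditional_kernel X Y Z K (density_quotient_kernel \<mu> k P)"
    using conditional_kernel_density by blast
next
  assume "(standard_space X \<and> countably_generated_space Y) \<or>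
      (standard_space X \<and> discrete_space Z) \<or> discrete_space Y"
  then show "disintegration_triple X Y Z"
    unfolding disintegration_triple_def
    using conditional_kernel_standard conditional_kernel_discrete by blast
qed

end
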